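(* Let $f:\mathbb{R}^2\to\mathbb{R}$ satisfy (f1)–(f7), assume that $x'=f(t,x)$ has an attractor-repeller pair $(\tilde a,\tilde r)$, and let $\Gamma:\mathbb{R}\to\mathbb{R}$ be bounded and continuous with finite limits $\gamma_\pm=\lim_{t\to\pm\infty}\Gamma(t)$. Fix $h>0$, and assume also that $\Gamma$ is nondecreasing, and the existence of $j_0\in\mathbb{Z}$, $n\in\mathbb{N}$ and $\nu_{j_0}=1,\nu_{j_0+1},\ldots,\nu_{j_0+n}=0$ in $[0,1]$ such that $$x((j+1)h,jh,b^{\nu_j}(jh))-b^{\nu_{j+1}}((j+1)h)\le\Gamma((j+1)h)-\Gamma(jh)$$ for $j\in\{j_0,\ldots,j_0+n-1\}$. Then the equation $x'=f(t,x-\Gamma^h(t))$ does not have an attractor-repeller pair; and it has no bounded solutions (defined on $\mathbb{R}$) if, in addition, one of these $n$ inequalities is strict.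
   Context: Conditions on a function $f:\mathbb{R}^2\to\mathbb{R}$ ("a.e. $t$" refers to Lebesgue measure on $\mathbb{R}$): (f1) $f$ is Borel measurable; (f2) for all $j\in\mathbb{N}$ there exists $m_j\in\mathbb{R}$ such that $\sup_{x\in[-j,j]}|f(t,x)|\le m_j$ for a.e. $t$; (f3) for all $j\in\mathbb{N}$ there exists $l_j\in\mathbb{R}$ such that $\sup_{x_1,x_2\in[-j,j],\,x_1\ne x_2}|f(t,x_2)-f(t,x_1)|/|x_2-x_1|\le l_j$ for a.e. $t$; (f4) for a.e. $t$, the map $x\mapsto f(t,x)$ is $C^1$; (f5) $f_x=\partial f/\partial x$ satisfies condition (f3); (f6) there exist a subset $\mathcal{R}\subseteq\mathbb{R}$ with full Lebesgue measure and $\delta>0$ such that $\limsup_{x\to\pm\infty}f(t,x)/x^2<-\delta$ uniformly on $t\in\mathcal{R}$; (f7) for all $j\in\mathbb{N}$ there exists $\delta_j>0$ such that $\sup_{x_1,x_2\in[-j,j],\,x_1\ne x_2}(f_x(t,x_2)-f_x(t,x_1))/(x_2-x_1)<-\delta_j$ for a.e. $t$. Solutions are Carathéodory solutions (absolutely continuous on compact intervals, satisfying the equation for a.e. $t$). $x(t,s,x_0)$ denotes the maximal solution of the unperturbed equation $x'=f(t,x)$ with value $x_0$ at $t=s$. $\Gamma^h$ is the piecewise constant function $\Gamma^h(t):=\Gamma(jh)$ for $t\in[jh,(j+1)h)$, $j\in\mathbb{Z}$. $b^\nu:=\nu\,\tilde a+(1-\nu)\,\tilde r$ for $\nu\in[0,1]$.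 Nondecreasing means $\Gamma(t_1)\le\Gamma(t_2)$ if $t_1<t_2$. Attractor-repeller pair. For an equation $x'=g(t,x)$ with $g$ satisfying (f1)–(f7) and having bounded solutions on $\mathbb{R}$, there are a maximal one $a$ and a minimal one $r$ (a solution is globally defined and bounded iff it lies between $r$ and $a$). The equation has an attractor-repeller pair $(a,r)$ if $a$ and $r$ are hyperbolic, $a$ attractive and $r$ repulsive: there exist $k\ge1,\beta>0$ with $\exp\int_s^t g_x(l,a(l))\,dl\le k e^{-\beta(t-s)}$ for $t\ge s$ and $\exp\int_s^t g_x(l,r(l))\,dl\le k e^{\beta(t-s)}$ for $t\le s$. This is equivalent to $\inf_{t\in\mathbb{R}}(a(t)-r(t))>0$. *)

theory Defs
  imports "HOL-Analysis.Analysis"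
begin

section \<open>Conditions on the right-hand side\<close>

text \<open>
  A map \<^term>\<open>f :: real \<Rightarrow> real \<Rightarrow> real\<close> is written in curried form, first time, then state. Suprema
  are taken in the extended reals, so that a bound on a supremum includes its finiteness and the
  supremum over the empty set (for \<open>j = 0\<close>) is \<open>-\<infinity>\<close>.
\<close>

definition state_deriv :: "(real \<Rightarrow> real \<Rightarrow> real) \<Rightarrow> real \<Rightarrow> real \<Rightarrow> real" where
  "state_deriv f t x = deriv (f t) x"

definition distinct_pairs :: "nat \<Rightarrow> (real \<times> real) set" where
  "distinct_pairs j =
     {(x1, x2). x1 \<in> {- real j..real j} \<and> x2 \<in> {- real j..real j} \<and> x1 \<noteq> x2}"

definition cond_f1 :: "(real \<Rightarrow> real \<Rightarrow> real) \<Rightarrow> bool" where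
  "cond_f1 f \<longleftrightarrow> (\<lambda>(t, x). f t x) \<in> borel_measurable borel"

definition cond_f2 :: "(real \<Rightarrow> real \<Rightarrow> real) \<Rightarrow> bool" where
  "cond_f2 f \<longleftrightarrow> (\<forall>j::nat. \<exists>m::real. AE t in lebesgue.
     (SUP x\<in>{- real j..real j}. ereal \<bar>f t x\<bar>) \<le> ereal m)"

definition cond_f3 :: "(real \<Rightarrow> real \<Rightarrow> real) \<Rightarrow> bool" where
  "cond_f3 f \<longleftrightarrow> (\<forall>j::nat. \<exists>l::real. AE t in lebesgue.
     (SUP (x1, x2)\<in>distinct_pairs j. ereal (\<bar>f t x2 - f t x1\<bar> / \<bar>x2 - x1\<bar>)) \<le> ereal l)"

definition cond_f4 :: "(real \<Rightarrow> real \<Rightarrow> real) \<Rightarrow> bool" where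
  "cond_f4 f \<longleftrightarrow> (AE t in lebesgue. f t C1_differentiable_on UNIV)"

definition cond_f5 :: "(real \<Rightarrow> real \<Rightarrow> real) \<Rightarrow> bool" where
  "cond_f5 f \<longleftrightarrow> cond_f3 (state_deriv f)"

text \<open>
  Uniformity of the upper limit in \<open>t \<in> R\<close> means that the supremum over \<open>t \<in> R\<close> is taken before the
  upper limit in \<open>x\<close>.
\<close>

definition cond_f6 :: "(real \<Rightarrow> real \<Rightarrow> real) \<Rightarrow> bool" where
  "cond_f6 f \<longleftrightarrow> (\<exists>R \<delta>. - R \<in> null_sets lebesgue \<and> \<delta> > 0 \<and>
     Limsup at_top (\<lambda>x. SUP t\<in>R. ereal (f t x / x\<^sup>2)) < ereal (- \<delta>) \<and>
     Limsup at_bot (\<lambda>x. SUP t\<in>R. ereal (f t x / x\<^sup>2)) < ereal (- \<delta>))"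

definition cond_f7 :: "(real \<Rightarrow> real \<Rightarrow> real) \<Rightarrow> bool" where
  "cond_f7 f \<longleftrightarrow> (\<forall>j::nat. \<exists>\<delta>>0. AE t in lebesgue.
     (SUP (x1, x2)\<in>distinct_pairs j.
        ereal ((state_deriv f t x2 - state_deriv f t x1) / (x2 - x1))) < ereal (- \<delta>))"


section \<open>Solutions\<close>

text \<open>
  The library has absolute continuity of measures only. Here \<^term>\<open>d\<close> ranges over the finite sets of
  nonoverlapping compact subintervals of \<open>[a, b]\<close>.
\<close>

definition abs_continuous_on_interval :: "real \<Rightarrow> real \<Rightarrow> (real \<Rightarrow> real) \<Rightarrow> bool" where
  "abs_continuous_on_interval a b u \<longleftrightarrow> (\<forall>\<epsilon>>0. \<exists>\<delta>>0. \<forall>d.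
     d division_of \<Union>d \<and> \<Union>d \<subseteq> {a..b} \<and> (\<Sum>k\<in>d. Sup k - Inf k) < \<delta> \<longrightarrow>
     (\<Sum>k\<in>d. \<bar>u (Sup k) - u (Inf k)\<bar>) < \<epsilon>)"

definition solution_on :: "(real \<Rightarrow> real \<Rightarrow> real) \<Rightarrow> real set \<Rightarrow> (real \<Rightarrow> real) \<Rightarrow> bool" where
  "solution_on g I u \<longleftrightarrow> is_interval I \<and>
     (\<forall>a b. a \<le> b \<and> {a..b} \<subseteq> I \<longrightarrow> abs_continuous_on_interval a b u) \<and>
     (AE t in lebesgue. t \<in> I \<longrightarrow> (u has_real_derivative g t (u t)) (at t within I))"

definition bounded_solution :: "(real \<Rightarrow> real \<Rightarrow> real) \<Rightarrow> (real \<Rightarrow> real) \<Rightarrow> bool" where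
  "bounded_solution g u \<longleftrightarrow> solution_on g UNIV u \<and> bounded (range u)"

definition maximal_solution ::
  "(real \<Rightarrow> real \<Rightarrow> real) \<Rightarrow> real \<Rightarrow> real \<Rightarrow> real set \<Rightarrow> (real \<Rightarrow> real) \<Rightarrow> bool" where
  "maximal_solution g s x0 I u \<longleftrightarrow> solution_on g I u \<and> s \<in> I \<and> u s = x0 \<and>
     (\<forall>J v. I \<subseteq> J \<and> solution_on g J v \<and> (\<forall>t\<in>I. v t = u t) \<longrightarrow> J = I)"

text \<open>
  The value at \<^term>\<open>t\<close> of the maximal solution through \<open>(s, x0)\<close>. It is meaningful when the maximal
  solution is unique and its domain contains \<^term>\<open>t\<close>; under the conditions above this is the case
  for all \<^term>\<open>t\<close> if \<open>x0\<close> lies between the values at \<open>s\<close> of two bounded solutions.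
\<close>

definition sol :: "(real \<Rightarrow> real \<Rightarrow> real) \<Rightarrow> real \<Rightarrow> real \<Rightarrow> real \<Rightarrow> real" where
  "sol g t s x0 = (THE y. \<exists>I u. maximal_solution g s x0 I u \<and> t \<in> I \<and> y = u t)"


section \<open>Attractor-repeller pairs\<close>

text \<open>
  The interval integral is signed, so for \<open>t \<le> s\<close> it is minus the integral over \<open>[t, s]\<close>. It is taken
  with respect to the completed measure, since the derivative in the state is only controlled
  for almost every time.
\<close>

definition attractor_repeller_pair ::
  "(real \<Rightarrow> real \<Rightarrow> real) \<Rightarrow> (real \<Rightarrow> real) \<Rightarrow> (real \<Rightarrow> real) \<Rightarrow> bool" where
  "attractor_repeller_pair g a r \<longleftrightarrow>
     bounded_solution g a \<and> bounded_solution g r \<and>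
     (\<forall>u. bounded_solution g u \<longrightarrow> (\<forall>t. r t \<le> u t \<and> u t \<le> a t)) \<and>
     (\<exists>k\<ge>1. \<exists>\<beta>>0.
        (\<forall>s t. s \<le> t \<longrightarrow>
           exp (LINT l=ereal s..ereal t|lebesgue. state_deriv g l (a l)) \<le> k * exp (- \<beta> * (t - s))) \<and>
        (\<forall>s t. t \<le> s \<longrightarrow>
           exp (LINT l=ereal s..ereal t|lebesgue. state_deriv g l (r l)) \<le> k * exp (\<beta> * (t - s))))"


section \<open>Piecewise constant transitions\<close>

definition step_transition :: "(real \<Rightarrow> real) \<Rightarrow> real \<Rightarrow> real \<Rightarrow> real" where
  "step_transition \<Gamma> h t = \<Gamma> (of_int \<lfloor>t / h\<rfloor> * h)"

lemma step_transition_eq: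
  assumes "h > 0" "t \<in> {of_int j * h..<(of_int j + 1) * h}"
  shows "step_transition \<Gamma> h t = \<Gamma> (of_int j * h)"
proof -
  have "\<lfloor>t / h\<rfloor> = j"
    using assms by (simp add: floor_eq_iff field_simps)
  then show ?thesis
    by (simp add: step_transition_def)
qed

definition convex_comb :: "(real \<Rightarrow> real) \<Rightarrow> (real \<Rightarrow> real) \<Rightarrow> real \<Rightarrow> real \<Rightarrow> real" where
  "convex_comb a r \<nu> t = \<nu> * a t + (1 - \<nu>) * r t"

end

theory Submission
  imports Defs
begin

text \<open>
  Let \<open>u\<close> be a bounded solution of the transition equation. The function \<open>w = u - \<Gamma>\<^sup>h\<close> follows the
  unperturbed equation on each interval between grid points and, \<open>\<Gamma>\<close> being nondecreasing, jumps downwards at the grid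
  points. Hence \<open>r \<le> w \<le> a\<close> at the grid points: otherwise the unperturbed solution through a value of
  \<open>w\<close> outside \<open>[r, a]\<close> would be squeezed between \<open>w\<close> and \<open>a\<close> in the past (or between \<open>w\<close> and \<open>r\<close> in the future), stay
  bounded in the other time direction by the sign of \<open>f\<close> for large states, and contradict the
  extremality of \<open>a\<close> and \<open>r\<close>. Starting from \<open>w \<le> a = b\<^sup>1\<close> at \<open>j\<^sub>0 h\<close>, the assumed inequalities propagate \<open>w \<le> b\<^sup>\<nu>\<close> from one
  grid point to the next, so that \<open>w \<le> r\<close> at \<open>(j\<^sub>0 + n) h\<close>, strictly if one of them is strict,
  which is impossible. Without strictness all bounded solutions agree at this point, hence
  everywhere, and one solution cannot be both attractive and repulsive.
\<close>

section \<open>Absolutely continuous functions and comparison\<close>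

lemma abs_continuous_on_intervalE:
  assumes "abs_continuous_on_interval a b u" "e > 0"
  obtains \<delta> where "\<delta> > 0" "\<And>d. \<lbrakk>d division_of \<Union>d; \<Union>d \<subseteq> {a..b}; (\<Sum>k\<in>d. Sup k - Inf k) < \<delta>\<rbrakk> \<Longrightarrow>
     (\<Sum>k\<in>d. \<bar>u (Sup k) - u (Inf k)\<bar>) < e"
proof -
  obtain \<delta> where \<delta>: "\<delta> > 0" "\<forall>d. d division_of \<Union>d \<and> \<Union>d \<subseteq> {a..b} \<and> (\<Sum>k\<in>d. Sup k - Inf k) < \<delta> \<longrightarrow>
     (\<Sum>k\<in>d. \<bar>u (Sup k) - u (Inf k)\<bar>) < e"
    using assms(1)[unfolded abs_continuous_on_interval_def, rule_format, OF assms(2)] by (elim exE conjE)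
  show ?thesis by (rule that[OF \<delta>(1)]) (use \<delta>(2) in blast)
qed

lemma abs_continuous_on_interval_subset:
  assumes "abs_continuous_on_interval a b u" "{c..d} \<subseteq> {a..b}"
  shows "abs_continuous_on_interval c d u"
  using assms unfolding abs_continuous_on_interval_def by (meson subset_trans)

lemma abs_continuous_on_interval_imp_continuous_on:
  assumes "abs_continuous_on_interval a b u"
  shows "continuous_on {a..b} u"
  unfolding continuous_on_iff
proof (intro ballI allI impI)
  fix x e :: real assume x: "x \<in> {a..b}" and "e > 0"
  then obtain \<delta> where "\<delta> > 0" and \<delta>: "\<And>d. d division_of \<Union>d \<Longrightarrow> \<Union>d \<subseteq> {a..b} \<Longrightarrow>
     (\<Sum>k\<in>d. Sup k - Inf k) < \<delta> \<Longrightarrow> (\<Sum>k\<in>d. \<bar>u (Sup k) - u (Inf k)\<bar>) < e"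
    using abs_continuous_on_intervalE[OF assms] by blast
  have small: "\<bar>u q - u p\<bar> < e" if "p \<le> q" "q - p < \<delta>" "p \<in> {a..b}" "q \<in> {a..b}" for p q
  proof -
    have "{{p..q}} division_of \<Union>{{p..q}}"
      using that division_of_self[of p q] by (simp add: box_real)
    from \<delta>[OF this] show ?thesis using that by simp
  qed
  have "dist (u y) (u x) < e" if "y \<in> {a..b}" "dist y x < \<delta>" for y
    using small[of x y] small[of y x] x that by (cases "x \<le> y") (auto simp: dist_real_def)
  then show "\<exists>d>0. \<forall>x'\<in>{a..b}. dist x' x < d \<longrightarrow> dist (u x') (u x) < e"
    using \<open>\<delta> > 0\<close> by blast
qed

lemma abs_continuous_on_interval_diff:
  assumes "abs_continuous_on_interval a b u" "abs_continuous_on_interval a b v"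
  shows "abs_continuous_on_interval a b (\<lambda>t. u t - v t)"
  unfolding abs_continuous_on_interval_def
proof (intro allI impI)
  fix e :: real assume "e > 0"
  then have "e / 2 > 0" by simp
  then obtain \<delta>1 where "\<delta>1 > 0" and 1: "\<And>d. d division_of \<Union>d \<Longrightarrow> \<Union>d \<subseteq> {a..b} \<Longrightarrow>
     (\<Sum>k\<in>d. Sup k - Inf k) < \<delta>1 \<Longrightarrow> (\<Sum>k\<in>d. \<bar>u (Sup k) - u (Inf k)\<bar>) < e / 2"
    using abs_continuous_on_intervalE[OF assms(1)] by blast
  from \<open>e / 2 > 0\<close> obtain \<delta>2 where "\<delta>2 > 0" and 2: "\<And>d. d division_of \<Union>d \<Longrightarrow> \<Union>d \<subseteq> {a..b} \<Longrightarrow>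
     (\<Sum>k\<in>d. Sup k - Inf k) < \<delta>2 \<Longrightarrow> (\<Sum>k\<in>d. \<bar>v (Sup k) - v (Inf k)\<bar>) < e / 2"
    using abs_continuous_on_intervalE[OF assms(2)] by blast
  have "(\<Sum>k\<in>d. \<bar>(u (Sup k) - v (Sup k)) - (u (Inf k) - v (Inf k))\<bar>) < e"
    if "d division_of \<Union>d" "\<Union>d \<subseteq> {a..b}" "(\<Sum>k\<in>d. Sup k - Inf k) < min \<delta>1 \<delta>2" for d
  proof -
    have "(\<Sum>k\<in>d. \<bar>(u (Sup k) - v (Sup k)) - (u (Inf k) - v (Inf k))\<bar>)
        \<le> (\<Sum>k\<in>d. \<bar>u (Sup k) - u (Inf k)\<bar> + \<bar>v (Sup k) - v (Inf k)\<bar>)"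
      by (intro sum_mono) linarith
    then show ?thesis using 1[OF that(1,2)] 2[OF that(1,2)] that(3) by (simp add: sum.distrib)
  qed
  then show "\<exists>\<delta>>0. \<forall>d. d division_of \<Union>d \<and> \<Union>d \<subseteq> {a..b} \<and> (\<Sum>k\<in>d. Sup k - Inf k) < \<delta> \<longrightarrow>
     (\<Sum>k\<in>d. \<bar>(u (Sup k) - v (Sup k)) - (u (Inf k) - v (Inf k))\<bar>) < e"
    using \<open>\<delta>1 > 0\<close> \<open>\<delta>2 > 0\<close> by (intro exI[of _ "min \<delta>1 \<delta>2"]) simp
qed

lemma division_of_real_Inf_le_Sup:
  fixes k :: "real set"
  assumes "d division_of i" "k \<in> d"
  shows "Inf k \<le> Sup k" "Inf k \<in> k" "Sup k \<in> k" "k = {Inf k..Sup k}" "measure lebesgue k = Sup k - Inf k"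
proof -
  obtain x y where "k = {x..y}" "x \<le> y"
    using division_ofD(3,4)[OF assms] by fastforce
  then show "Inf k \<le> Sup k" "Inf k \<in> k" "Sup k \<in> k" "k = {Inf k..Sup k}" "measure lebesgue k = Sup k - Inf k"
    by auto
qed

text \<open>This supplies absolute continuity for primitives of bounded functions, the form in which
  solutions are constructed below.\<close>

lemma lipschitz_imp_abs_continuous_on_interval:
  assumes "\<And>x y. \<lbrakk>x \<in> {a..b}; y \<in> {a..b}\<rbrakk> \<Longrightarrow> \<bar>u y - u x\<bar> \<le> C * \<bar>y - x\<bar>"
  shows "abs_continuous_on_interval a b u"
  unfolding abs_continuous_on_interval_def
proof (intro allI impI)
  fix e :: real assume "e > 0"
  have "(\<Sum>k\<in>d. \<bar>u (Sup k) - u (Inf k)\<bar>) < e"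
    if d: "d division_of \<Union>d" "\<Union>d \<subseteq> {a..b}" and small: "(\<Sum>k\<in>d. Sup k - Inf k) < e / (\<bar>C\<bar> + 1)" for d
  proof -
    have "\<bar>u (Sup k) - u (Inf k)\<bar> \<le> \<bar>C\<bar> * (Sup k - Inf k)" if "k \<in> d" for k
    proof -
      have "Sup k \<in> {a..b}" "Inf k \<in> {a..b}"
        using division_of_real_Inf_le_Sup[OF d(1) that] d(2) that by blast+
      then have "\<bar>u (Sup k) - u (Inf k)\<bar> \<le> C * \<bar>Sup k - Inf k\<bar>"
        using assms by blast
      also have "\<dots> \<le> \<bar>C\<bar> * \<bar>Sup k - Inf k\<bar>" by (intro mult_right_mono) auto
      finally show ?thesis using division_of_real_Inf_le_Sup(1)[OF d(1) that] by simp
    qed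
    then have "(\<Sum>k\<in>d. \<bar>u (Sup k) - u (Inf k)\<bar>) \<le> \<bar>C\<bar> * (\<Sum>k\<in>d. Sup k - Inf k)"
      by (simp add: sum_distrib_left sum_mono)
    also have "\<dots> \<le> (\<bar>C\<bar> + 1) * (\<Sum>k\<in>d. Sup k - Inf k)"
      using division_of_real_Inf_le_Sup(1)[OF d(1)] by (intro mult_right_mono sum_nonneg) auto
    also have "\<dots> < e" using small by (simp add: field_simps)
    finally show ?thesis .
  qed
  moreover have "e / (\<bar>C\<bar> + 1) > 0" using \<open>e > 0\<close> by (simp add: add_nonneg_pos)
  ultimately show "\<exists>\<delta>>0. \<forall>d. d division_of \<Union>d \<and> \<Union>d \<subseteq> {a..b} \<and> (\<Sum>k\<in>d. Sup k - Inf k) < \<delta> \<longrightarrow>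
     (\<Sum>k\<in>d. \<bar>u (Sup k) - u (Inf k)\<bar>) < e"
    by blast
qed

lemma abs_continuous_on_interval_const: "abs_continuous_on_interval a b (\<lambda>_. c)"
  by (rule lipschitz_imp_abs_continuous_on_interval[of _ _ _ 0]) simp

lemma negligible_subset_open_measure_less:
  assumes "negligible N" "\<delta> > 0"
  obtains U where "open U" "N \<subseteq> U" "U \<in> lmeasurable" "measure lebesgue U < \<delta>"
proof -
  have N: "N \<in> lmeasurable" "measure lebesgue N = 0" using assms(1) by (auto simp: negligible_iff_measure)
  then obtain U where U: "open U" "N \<subseteq> U" "U - N \<in> lmeasurable" "emeasure lebesgue (U - N) < ennreal \<delta>"
    using sets_lebesgue_outer_open[of N \<delta>] assms(2) by blast
  then have "measure lebesgue (U - N) < \<delta>"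
    by (metis emeasure_eq_measure2 ennreal_less_iff measure_nonneg)
  moreover have "U = (U - N) \<union> N" using U by blast
  then have "U \<in> lmeasurable" "measure lebesgue U \<le> measure lebesgue (U - N) + measure lebesgue N"
    using U(3) N(1) by (metis fmeasurable.Un, metis fmeasurableD measure_Un_le)
  ultimately show ?thesis using that U N by auto
qed

text \<open>The increment is split at \<open>t\<close>. Since \<open>x \<le> t \<le> y\<close>, the
  two one-sided errors add up to \<open>e * (y - x)\<close>; tags of a tagged division lie in their
  intervals in just this way.\<close>

lemma has_real_derivative_straddle:
  fixes u :: "real \<Rightarrow> real"
  assumes "(u has_real_derivative D) (at t within S)" "e > 0"
  obtains r where "r > 0"
    "\<And>x y. \<lbrakk>x \<in> S; y \<in> S; x \<le> t; t \<le> y; \<bar>x - t\<bar> < r; \<bar>y - t\<bar> < r\<rbrakk> \<Longrightarrow> u y - u x \<le> (D + e) * (y - x)"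
proof -
  have "(u has_derivative (*) D) (at t within S)" using assms(1) by (simp add: has_field_derivative_def)
  then obtain r where r: "r > 0" "\<And>y. y \<in> S \<Longrightarrow> \<bar>y - t\<bar> < r \<Longrightarrow> \<bar>u y - u t - D * (y - t)\<bar> \<le> e * \<bar>y - t\<bar>"
    using \<open>e > 0\<close> unfolding has_derivative_within_alt by (metis real_norm_def)
  show ?thesis
  proof (rule that[OF r(1)])
    fix x y assume xy: "x \<in> S" "y \<in> S" "x \<le> t" "t \<le> y" "\<bar>x - t\<bar> < r" "\<bar>y - t\<bar> < r"
    then show "u y - u x \<le> (D + e) * (y - x)"
      using r(2)[of x] r(2)[of y] by (auto simp: algebra_simps abs_if split: if_splits)
  qed
qed

text \<open>
  Cousin's lemma: tags outside the null set contribute at most \<open>K + e\<close> times the length, and the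
  intervals tagged in the null set have small total length, so that absolute continuity applies.
\<close>

lemma abs_continuous_AE_derivative_le:
  assumes "a \<le> b" and ac: "abs_continuous_on_interval a b u"
    and ae: "AE t in lebesgue. t \<in> {a..b} \<longrightarrow> (\<exists>D\<le>K. (u has_real_derivative D) (at t within {a..b}))"
  shows "u b - u a \<le> K * (b - a)"
proof -
  \<comment> \<open>Three errors add up: \<open>e * (b - a)\<close> from the slope
    \<open>K + e\<close>, \<open>e\<close> from the increments of \<open>u\<close> over intervals
    tagged in \<open>N\<close>, and \<open>e\<close> from the total length of these intervals times
    \<open>K + e\<close>.\<close>
  have bound: "u b - u a \<le> K * (b - a) + e * (b - a + 2)" if "e > 0" for e
  proof -
    obtain \<delta> where "\<delta> > 0" and \<delta>: "\<And>d. d division_of \<Union>d \<Longrightarrow> \<Union>d \<subseteq> {a..b} \<Longrightarrow>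
       (\<Sum>k\<in>d. Sup k - Inf k) < \<delta> \<Longrightarrow> (\<Sum>k\<in>d. \<bar>u (Sup k) - u (Inf k)\<bar>) < e"
      using abs_continuous_on_intervalE[OF ac \<open>e > 0\<close>] by blast
    obtain N where N: "N \<in> null_sets lebesgue"
      and der: "\<And>t. t \<in> {a..b} - N \<Longrightarrow> \<exists>D\<le>K. (u has_real_derivative D) (at t within {a..b})"
      using ae unfolding eventually_ae_filter by fastforce
    \<comment> \<open>The bound \<open>\<delta>\<close> feeds absolute continuity; the other one
      keeps \<open>\<bar>K + e\<bar>\<close> times the length of the intervals tagged in
      \<open>N\<close> below \<open>e\<close>.\<close>
    define \<eta> where "\<eta> = min \<delta> (e / (\<bar>K + e\<bar> + 1))"
    have "\<eta> > 0" using \<open>\<delta> > 0\<close> \<open>e > 0\<close> by (simp add: \<eta>_def add_nonneg_pos)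
    obtain U where U: "open U" "N \<subseteq> U" "U \<in> lmeasurable" "measure lebesgue U < \<eta>"
      using negligible_subset_open_measure_less[of N \<eta>] N \<open>\<eta> > 0\<close> by (auto simp: negligible_iff_null_sets)
    have "\<exists>r>0. t \<in> {a..b} - N \<longrightarrow> (\<forall>x\<in>{a..b}. \<forall>y\<in>{a..b}. x \<le> t \<and> t \<le> y \<and> \<bar>x - t\<bar> < r \<and> \<bar>y - t\<bar> < r \<longrightarrow>
        u y - u x \<le> (K + e) * (y - x))" for t
    proof (cases "t \<in> {a..b} - N")
      case True
      then obtain D where D: "D \<le> K" "(u has_real_derivative D) (at t within {a..b})" using der by blast
      obtain r where "r > 0" and r: "\<And>x y. \<lbrakk>x \<in> {a..b}; y \<in> {a..b}; x \<le> t; t \<le> y; \<bar>x - t\<bar> < r; \<bar>y - t\<bar> < r\<rbrakk>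
          \<Longrightarrow> u y - u x \<le> (D + e) * (y - x)"
        using has_real_derivative_straddle[OF D(2) \<open>e > 0\<close>] by blast
      have "u y - u x \<le> (K + e) * (y - x)"
        if "x \<in> {a..b}" "y \<in> {a..b}" "x \<le> t \<and> t \<le> y \<and> \<bar>x - t\<bar> < r \<and> \<bar>y - t\<bar> < r" for x y
      proof -
        have "u y - u x \<le> (D + e) * (y - x)" using r that by blast
        also have "\<dots> \<le> (K + e) * (y - x)" using D(1) that by (intro mult_right_mono) auto
        finally show ?thesis .
      qed
      then show ?thesis using \<open>r > 0\<close> by blast
    qed (auto intro: exI[of _ 1])
    then obtain r where r0: "\<And>t. r t > 0" and r: "\<And>t x y. \<lbrakk>t \<in> {a..b} - N; x \<in> {a..b}; y \<in> {a..b};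
        x \<le> t; t \<le> y; \<bar>x - t\<bar> < r t; \<bar>y - t\<bar> < r t\<rbrakk> \<Longrightarrow> u y - u x \<le> (K + e) * (y - x)"
      by metis
    \<comment> \<open>For tags in \<open>N\<close> the gauge is all of \<open>U\<close> instead of a
      ball, so fineness places every interval tagged in \<open>N\<close> inside \<open>U\<close>,
      whatever its length.\<close>
    define \<gamma> where "\<gamma> t = (if t \<in> N then U else ball t (r t))" for t
    have "gauge \<gamma>" using U r0 by (auto simp: gauge_def \<gamma>_def)
    then obtain p where p: "p tagged_division_of {a..b}" and fine: "\<gamma> fine p"
      using fine_division_exists_real by blast
    have fin: "finite p" using p by blast
    define q where "q = {x \<in> p. fst x \<in> N}"
    have q: "q \<subseteq> p" "finite q" using fin by (auto simp: q_def)
    have qpart: "q tagged_partial_division_of {a..b}"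
      using p q(1) by (meson tagged_division_of_def tagged_partial_division_subset)
    define d where "d = snd ` q"
    have d: "d division_of \<Union>d"
      unfolding d_def by (rule partial_division_of_tagged_division[OF qpart])
    have dab: "\<Union>d \<subseteq> {a..b}"
      using tagged_partial_division_ofD(3)[OF qpart] unfolding d_def by fastforce
    have dU: "\<Union>d \<subseteq> U"
      using fineD[OF fine] q(1) by (fastforce simp: d_def q_def \<gamma>_def)
    have sumd: "(\<Sum>k\<in>d. F (Sup k) - F (Inf k)) = (\<Sum>(x, k)\<in>q. F (Sup k) - F (Inf k))" for F :: "real \<Rightarrow> real"
    proof -
      \<comment> \<open>An interval may occur in \<open>q\<close> under two tags, but only if its
        interior is empty, and then its increment is 0. The value at \<open>{}\<close> is set to 0
        because \<open>sum.over_tagged_division_lemma\<close> also tests empty boxes.\<close>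
      define G where "G k = (if k = {} then 0 else F (Sup k) - F (Inf k))" for k
      have "G (cbox x y) = 0" if "box x y = {}" for x y :: real
        using that by (auto simp: G_def)
      from sum.over_tagged_division_lemma[OF tagged_partial_division_of_Union_self[OF qpart], of G, OF this]
      have "(\<Sum>(x, k)\<in>q. G k) = (\<Sum>k\<in>d. G k)" by (simp add: d_def)
      moreover have "k \<noteq> {}" if "k \<in> d" for k using division_ofD(3)[OF d that] .
      then have "G k = F (Sup k) - F (Inf k)" if "k \<in> d" for k using that by (simp add: G_def)
      then have "(\<Sum>k\<in>d. G k) = (\<Sum>k\<in>d. F (Sup k) - F (Inf k))"
        "(\<Sum>(x, k)\<in>q. G k) = (\<Sum>(x, k)\<in>q. F (Sup k) - F (Inf k))"
        by (auto simp: d_def split_def intro!: sum.cong)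
      ultimately show ?thesis by simp
    qed
    have len: "(\<Sum>k\<in>d. Sup k - Inf k) = measure lebesgue (\<Union>d)"
      using content_division[OF d] division_of_real_Inf_le_Sup(5)[OF d] by simp
    also have "\<dots> \<le> measure lebesgue U"
      using dU U(3) d by (intro measure_mono_fmeasurable) (auto simp: fmeasurableD lmeasurable_division)
    finally have small: "(\<Sum>k\<in>d. Sup k - Inf k) < \<eta>" using U(4) by linarith
    have len0: "0 \<le> (\<Sum>k\<in>d. Sup k - Inf k)" by (simp add: len)
    have "(\<Sum>(x, k)\<in>q. u (Sup k) - u (Inf k)) \<le> (\<Sum>k\<in>d. \<bar>u (Sup k) - u (Inf k)\<bar>)"
      unfolding sumd[symmetric] by (intro sum_mono) auto
    also have "\<dots> < e" using \<delta>[OF d dab] small by (simp add: \<eta>_def)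
    finally have sumq: "(\<Sum>(x, k)\<in>q. u (Sup k) - u (Inf k)) < e" .
    have rest: "(\<Sum>(x, k)\<in>p - q. u (Sup k) - u (Inf k)) \<le> (\<Sum>(x, k)\<in>p - q. (K + e) * (Sup k - Inf k))"
    proof (intro sum_mono, clarify)
      fix t k assume tk: "(t, k) \<in> p" "(t, k) \<notin> q"
      then have "t \<notin> N" by (auto simp: q_def)
      have kp: "t \<in> k" "k \<subseteq> {a..b}" using tagged_division_ofD(2,3)[OF p tk(1)] by auto
      obtain x y where k: "k = {x..y}" using tagged_division_ofD(4)[OF p tk(1)] by auto
      have "k \<subseteq> ball t (r t)" using fineD[OF fine tk(1)] \<open>t \<notin> N\<close> by (auto simp: \<gamma>_def)
      moreover have xy: "x \<le> t" "t \<le> y" "x \<in> k" "y \<in> k" using kp k by auto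
      ultimately have "x \<in> ball t (r t)" "y \<in> ball t (r t)" by blast+
      then show "u (Sup k) - u (Inf k) \<le> (K + e) * (Sup k - Inf k)"
        using r[of t x y] \<open>t \<notin> N\<close> kp xy k by (auto simp: dist_real_def)
    qed
    have split: "(\<Sum>(x, k)\<in>p. F k) = (\<Sum>(x, k)\<in>p - q. F k) + (\<Sum>(x, k)\<in>q. F k)" for F :: "real set \<Rightarrow> real"
      by (rule sum.subset_diff[OF q(1) fin])
    have "b - a = (\<Sum>(x, k)\<in>p. Sup k - Inf k)"
      using additive_tagged_division_1[OF \<open>a \<le> b\<close> p, of "\<lambda>x. x"] by simp
    then have rlen: "(\<Sum>(x, k)\<in>p - q. Sup k - Inf k) = b - a - (\<Sum>k\<in>d. Sup k - Inf k)"
      using split[of "\<lambda>k. Sup k - Inf k"] sumd[of "\<lambda>x. x"] by simp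
    \<comment> \<open>The factor \<open>K + e\<close> may be negative; leaving out the intervals
      tagged in \<open>N\<close> then raises the sum, but by at most \<open>e\<close>.\<close>
    have "- (K + e) * (\<Sum>k\<in>d. Sup k - Inf k) \<le> (\<bar>K + e\<bar> + 1) * (\<Sum>k\<in>d. Sup k - Inf k)"
      using len0 by (intro mult_right_mono) auto
    also have "\<dots> \<le> e" using small by (simp add: \<eta>_def field_simps)
    finally have corr: "- (K + e) * (\<Sum>k\<in>d. Sup k - Inf k) \<le> e" .
    have "u b - u a = (\<Sum>(x, k)\<in>p. u (Sup k) - u (Inf k))"
      using additive_tagged_division_1[OF \<open>a \<le> b\<close> p, of u] by simp
    also have "\<dots> \<le> (\<Sum>(x, k)\<in>p - q. (K + e) * (Sup k - Inf k)) + e"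
      using split[of "\<lambda>k. u (Sup k) - u (Inf k)"] rest sumq by linarith
    also have "(\<Sum>(x, k)\<in>p - q. (K + e) * (Sup k - Inf k)) = (K + e) * (b - a - (\<Sum>k\<in>d. Sup k - Inf k))"
      unfolding rlen[symmetric] sum_distrib_left by (simp add: split_def)
    also have "\<dots> + e \<le> K * (b - a) + e * (b - a + 2)"
      using corr by (simp add: algebra_simps)
    finally show ?thesis .
  qed
  show ?thesis
  proof (rule field_le_epsilon)
    fix e :: real assume "e > 0"
    moreover have "b - a + 2 > 0" using \<open>a \<le> b\<close> by simp
    ultimately show "u b - u a \<le> K * (b - a) + e"
      using bound[of "e / (b - a + 2)"] by simp
  qed
qed

section \<open>One-sided Gronwall comparison, forward and backward in time\<close>

lemma AE_lebesgue_neq: "AE t in lebesgue. t \<noteq> (c::real)"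
  by (intro AE_completion AE_lborel_singleton)

text \<open>A Gronwall argument without exponentials: beyond the last point \<open>\<sigma>\<close>
  with \<open>z \<sigma> \<le> 0\<close>, the maximum \<open>z p\<close> over a short window is
  reached from a nonpositive value at slope at most \<open>L * z p\<close>, hence is at most
  \<open>z p / 2\<close>. Only times with \<open>0 < z t\<close> are constrained, so the lemma
  serves Lipschitz differences as well as barriers with \<open>L = 0\<close>.\<close>

lemma comparison_forward:
  assumes "\<alpha> \<le> \<beta>" and ac: "abs_continuous_on_interval \<alpha> \<beta> z" and "z \<alpha> \<le> 0" "L \<ge> 0"
    and ae: "AE t in lebesgue. t \<in> {\<alpha>..\<beta>} \<and> 0 < z t \<longrightarrow>
      (\<exists>D\<le>L * z t. (z has_real_derivative D) (at t within {\<alpha>..\<beta>}))"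
  shows "z \<beta> \<le> 0"
proof (rule ccontr)
  assume "\<not> z \<beta> \<le> 0"
  have cont: "continuous_on {\<alpha>..\<beta>} z" by (rule abs_continuous_on_interval_imp_continuous_on[OF ac])
  define S where "S = {\<alpha>..\<beta>} \<inter> z -` {..0}"
  have "closed S" unfolding S_def by (rule continuous_closed_preimage[OF cont]) auto
  then have "compact S" by (metis S_def compact_Int_closed compact_Icc Int_absorb Int_assoc)
  moreover have "\<alpha> \<in> S" using assms by (auto simp: S_def)
  ultimately obtain \<sigma> where \<sigma>: "\<sigma> \<in> S" "\<And>t. t \<in> S \<Longrightarrow> t \<le> \<sigma>"
    using compact_attains_sup[of S] by blast
  have s: "\<alpha> \<le> \<sigma>" "\<sigma> < \<beta>" "z \<sigma> \<le> 0" using \<sigma>(1) \<open>\<not> z \<beta> \<le> 0\<close> by (auto simp: S_def less_le)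
  have pos: "z t > 0" if "\<sigma> < t" "t \<le> \<beta>" for t
    using \<sigma>(2)[of t] that s by (force simp: S_def)
  \<comment> \<open>The window length makes \<open>L * (p - \<sigma>) \<le> 1 / 2\<close>, also when
    \<open>L = 0\<close>.\<close>
  define \<eta> where "\<eta> = min \<beta> (\<sigma> + 1 / (2 * L + 1))"
  have \<eta>: "\<sigma> < \<eta>" "\<eta> \<le> \<beta>" using s \<open>L \<ge> 0\<close> by (auto simp: \<eta>_def)
  obtain p where p: "p \<in> {\<sigma>..\<eta>}" "\<And>t. t \<in> {\<sigma>..\<eta>} \<Longrightarrow> z t \<le> z p"
    using continuous_attains_sup[of "{\<sigma>..\<eta>}" z] continuous_on_subset[OF cont, of "{\<sigma>..\<eta>}"] \<eta> s by force
  have zp: "z p > 0" using p(2)[of \<eta>] pos[of \<eta>] \<eta> by auto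
  then have "\<sigma> < p" using s p(1) by (auto simp: less_le)
  have "z p - z \<sigma> \<le> (L * z p) * (p - \<sigma>)"
  proof (rule abs_continuous_AE_derivative_le)
    show "abs_continuous_on_interval \<sigma> p z"
      using ac s p \<eta> by (auto intro: abs_continuous_on_interval_subset)
    \<comment> \<open>The hypothesis gives nothing at \<open>\<sigma>\<close>, where
      \<open>z\<close> is not positive; this single point is discarded as a null set.\<close>
    show "AE t in lebesgue. t \<in> {\<sigma>..p} \<longrightarrow> (\<exists>D\<le>L * z p. (z has_real_derivative D) (at t within {\<sigma>..p}))"
      using ae AE_lebesgue_neq[of \<sigma>]
    proof eventually_elim
      case (elim t)
      show ?case
      proof
        assume t: "t \<in> {\<sigma>..p}"
        then have "t \<in> {\<alpha>..\<beta>}" "0 < z t" using pos[of t] elim s p(1) \<eta> by auto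
        then obtain D where D: "D \<le> L * z t" "(z has_real_derivative D) (at t within {\<alpha>..\<beta>})"
          using elim by blast
        have "L * z t \<le> L * z p" using p t \<open>L \<ge> 0\<close> by (intro mult_left_mono) auto
        moreover have "(z has_real_derivative D) (at t within {\<sigma>..p})"
          by (rule DERIV_subset[OF D(2)]) (use s p(1) \<eta> in auto)
        ultimately show "\<exists>D\<le>L * z p. (z has_real_derivative D) (at t within {\<sigma>..p})"
          using D(1) by (meson order_trans)
      qed
    qed
  qed (use \<open>\<sigma> < p\<close> in auto)
  also have "\<dots> = z p * (L * (p - \<sigma>))" by simp
  also have "L * (p - \<sigma>) \<le> L * (1 / (2 * L + 1))"
    using p(1) \<open>L \<ge> 0\<close> by (intro mult_left_mono) (auto simp: \<eta>_def)
  also have "\<dots> \<le> 1 / 2" using \<open>L \<ge> 0\<close> by (simp add: field_simps)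
  finally show False using zp s(3) by simp
qed

text \<open>The time mirror of \<open>comparison_forward\<close>: the first point with
  \<open>z \<le> 0\<close> takes the place of the last one, and the growth estimate is applied to
  \<open>0 - z t\<close>, a form to which the closure under differences applies directly.\<close>

lemma comparison_backward:
  assumes "\<alpha> \<le> \<beta>" and ac: "abs_continuous_on_interval \<alpha> \<beta> z" and "z \<beta> \<le> 0" "L \<ge> 0"
    and ae: "AE t in lebesgue. t \<in> {\<alpha>..\<beta>} \<and> 0 < z t \<longrightarrow>
      (\<exists>D\<ge>- L * z t. (z has_real_derivative D) (at t within {\<alpha>..\<beta>}))"
  shows "z \<alpha> \<le> 0"
proof (rule ccontr)
  assume "\<not> z \<alpha> \<le> 0"
  have cont: "continuous_on {\<alpha>..\<beta>} z" by (rule abs_continuous_on_interval_imp_continuous_on[OF ac])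
  define S where "S = {\<alpha>..\<beta>} \<inter> z -` {..0}"
  have "closed S" unfolding S_def by (rule continuous_closed_preimage[OF cont]) auto
  then have "compact S" by (metis S_def compact_Int_closed compact_Icc Int_absorb Int_assoc)
  moreover have "\<beta> \<in> S" using assms by (auto simp: S_def)
  ultimately obtain \<sigma> where \<sigma>: "\<sigma> \<in> S" "\<And>t. t \<in> S \<Longrightarrow> \<sigma> \<le> t"
    using compact_attains_inf[of S] by blast
  have s: "\<alpha> < \<sigma>" "\<sigma> \<le> \<beta>" "z \<sigma> \<le> 0" using \<sigma>(1) \<open>\<not> z \<alpha> \<le> 0\<close> by (auto simp: S_def less_le)
  have pos: "z t > 0" if "t < \<sigma>" "\<alpha> \<le> t" for t
    using \<sigma>(2)[of t] that s by (force simp: S_def)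
  define \<eta> where "\<eta> = max \<alpha> (\<sigma> - 1 / (2 * L + 1))"
  have \<eta>: "\<eta> < \<sigma>" "\<alpha> \<le> \<eta>" using s \<open>L \<ge> 0\<close> by (auto simp: \<eta>_def)
  obtain p where p: "p \<in> {\<eta>..\<sigma>}" "\<And>t. t \<in> {\<eta>..\<sigma>} \<Longrightarrow> z t \<le> z p"
    using continuous_attains_sup[of "{\<eta>..\<sigma>}" z] continuous_on_subset[OF cont, of "{\<eta>..\<sigma>}"] \<eta> s by force
  have zp: "z p > 0" using p(2)[of \<eta>] pos[of \<eta>] \<eta> by auto
  then have "p < \<sigma>" using s p(1) by (auto simp: less_le)
  have "(0 - z \<sigma>) - (0 - z p) \<le> (L * z p) * (\<sigma> - p)"
  proof (rule abs_continuous_AE_derivative_le[where u = "\<lambda>t. 0 - z t"])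
    show "abs_continuous_on_interval p \<sigma> (\<lambda>t. 0 - z t)"
      by (intro abs_continuous_on_interval_diff abs_continuous_on_interval_const
          abs_continuous_on_interval_subset[OF ac]) (use s p(1) \<eta> in auto)
    show "AE t in lebesgue. t \<in> {p..\<sigma>} \<longrightarrow> (\<exists>D\<le>L * z p. ((\<lambda>t. 0 - z t) has_real_derivative D) (at t within {p..\<sigma>}))"
      using ae AE_lebesgue_neq[of \<sigma>]
    proof eventually_elim
      case (elim t)
      show ?case
      proof
        assume t: "t \<in> {p..\<sigma>}"
        then have "t \<in> {\<alpha>..\<beta>}" "0 < z t" using pos[of t] elim s p(1) \<eta> by auto
        then obtain D where D: "- L * z t \<le> D" "(z has_real_derivative D) (at t within {\<alpha>..\<beta>})"
          using elim by blast
        have "L * z t \<le> L * z p" using p t \<open>L \<ge> 0\<close> by (intro mult_left_mono) auto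
        moreover have "(z has_real_derivative D) (at t within {p..\<sigma>})"
          by (rule DERIV_subset[OF D(2)]) (use s p(1) \<eta> in auto)
        then have "((\<lambda>t. 0 - z t) has_real_derivative - D) (at t within {p..\<sigma>})"
          by (auto intro!: derivative_eq_intros)
        ultimately show "\<exists>D\<le>L * z p. ((\<lambda>t. 0 - z t) has_real_derivative D) (at t within {p..\<sigma>})"
          using D(1) by (intro exI[of _ "- D"]) auto
      qed
    qed
  qed (use \<open>p < \<sigma>\<close> in auto)
  also have "\<dots> = z p * (L * (\<sigma> - p))" by simp
  also have "L * (\<sigma> - p) \<le> L * (1 / (2 * L + 1))"
    using p(1) \<open>L \<ge> 0\<close> by (intro mult_left_mono) (auto simp: \<eta>_def)
  also have "\<dots> \<le> 1 / 2" using \<open>L \<ge> 0\<close> by (simp add: field_simps)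
  finally show False using zp s(3) by simp
qed


section \<open>Global existence of solutions\<close>

text \<open>Lebesgue differentiation. The library statement yields right difference quotients only;
  the left ones come from the reflected function, whose exceptional set is reflected back.\<close>

lemma AE_has_derivative_primitive:
  fixes \<phi> I :: "real \<Rightarrow> real"
  assumes int: "\<And>x y. \<phi> integrable_on {x..y}"
    and prim: "\<And>x y. x \<le> y \<Longrightarrow> I y - I x = integral {x..y} \<phi>"
  shows "AE t in lebesgue. (I has_real_derivative \<phi> t) (at t)"
proof -
  obtain N1 where N1: "negligible N1" "\<And>x e. x \<notin> N1 \<Longrightarrow> 0 < e \<Longrightarrow>
      \<exists>d>0. \<forall>h. 0 < h \<and> h < d \<longrightarrow> \<bar>integral {x..x + h} \<phi> / h - \<phi> x\<bar> < e"
    using integrable_ccontinuous_explicit[of \<phi>] int by (auto simp: field_simps)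
  have "(\<lambda>t. \<phi> (- t)) integrable_on {x..y}" for x y
    using Henstock_Kurzweil_Integration.integrable_reflect_real[of \<phi> "- x" "- y"] int by simp
  then obtain N2 where N2: "negligible N2" "\<And>x e. x \<notin> N2 \<Longrightarrow> 0 < e \<Longrightarrow>
      \<exists>d>0. \<forall>h. 0 < h \<and> h < d \<longrightarrow> \<bar>integral {x..x + h} (\<lambda>t. \<phi> (- t)) / h - \<phi> (- x)\<bar> < e"
    using integrable_ccontinuous_explicit[of "\<lambda>t. \<phi> (- t)"] by (auto simp: field_simps)
  have neg: "negligible (uminus ` N2)"
    by (rule negligible_differentiable_image_negligible[OF _ N2(1)]) (auto intro: linear_imp_differentiable_on linear_uminus)
  have "(I has_real_derivative \<phi> t) (at t)" if "t \<notin> N1 \<union> uminus ` N2" for t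
    unfolding has_field_derivative_iff
  proof (rule tendstoI)
    fix e :: real assume "e > 0"
    have "t \<notin> N1" "- t \<notin> N2" using that by (auto simp: image_iff)
    obtain d1 where d1: "d1 > 0" "\<And>h. 0 < h \<Longrightarrow> h < d1 \<Longrightarrow> \<bar>integral {t..t + h} \<phi> / h - \<phi> t\<bar> < e"
      using N1(2)[OF \<open>t \<notin> N1\<close> \<open>e > 0\<close>] by blast
    obtain d2 where d2: "d2 > 0" "\<And>h. 0 < h \<Longrightarrow> h < d2 \<Longrightarrow> \<bar>integral {- t..- t + h} (\<lambda>t. \<phi> (- t)) / h - \<phi> t\<bar> < e"
      using N2(2)[OF \<open>- t \<notin> N2\<close> \<open>e > 0\<close>] by auto
    have "\<bar>(I y - I t) / (y - t) - \<phi> t\<bar> < e" if "y \<noteq> t" "\<bar>y - t\<bar> < min d1 d2" for y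
    proof (cases "t < y")
      case True
      then show ?thesis using d1(2)[of "y - t"] prim[of t y] that by simp
    next
      case False
      have "integral {- t..- t + (t - y)} (\<lambda>t. \<phi> (- t)) = integral {y..t} \<phi>"
        using Henstock_Kurzweil_Integration.integral_reflect_real[of t y \<phi>] by simp
      moreover have "(I y - I t) / (y - t) = (I t - I y) / (t - y)" by (metis minus_diff_eq minus_divide_divide)
      ultimately show ?thesis using d2(2)[of "t - y"] prim[of y t] that False by simp
    qed
    then show "\<forall>\<^sub>F y in at t. dist ((I y - I t) / (y - t)) (\<phi> t) < e"
      unfolding eventually_at using d1(1) d2(1)
      by (intro exI[of _ "min d1 d2"]) (auto simp: dist_real_def)
  qed
  moreover have "N1 \<union> uminus ` N2 \<in> null_sets lebesgue"
    using N1(1) neg by (simp add: negligible_iff_null_sets[symmetric] negligible_Un)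
  ultimately show ?thesis
    by (intro AE_I'[of "N1 \<union> uminus ` N2"]) auto
qed

text \<open>The oriented integral from \<open>s\<close> to \<open>t\<close>: for
  \<open>s \<noteq> t\<close> one of the two intervals is empty, and for \<open>s = t\<close> both
  integrals vanish.\<close>

definition primitive_from :: "real \<Rightarrow> (real \<Rightarrow> real) \<Rightarrow> real \<Rightarrow> real" where
  "primitive_from s \<phi> t = integral {s..t} \<phi> - integral {t..s} \<phi>"

lemma primitive_from_self: "primitive_from s \<phi> s = 0"
  by (simp add: primitive_from_def)

lemma primitive_from_diff:
  assumes int: "\<And>x y. \<phi> integrable_on {x..y}" and "x \<le> y"
  shows "primitive_from s \<phi> y - primitive_from s \<phi> x = integral {x..y} \<phi>"
proof -
  have eq: "integral {p..q} \<phi> + integral {q..r} \<phi> = integral {p..r} \<phi>" if "p \<le> q" "q \<le> r" for p q r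
    using that by (intro Henstock_Kurzweil_Integration.integral_combine int)
  consider "s \<le> x" | "x < s" "s \<le> y" | "y < s" by linarith
  then show ?thesis
  proof cases
    case 1
    then show ?thesis using eq[of s x y] \<open>x \<le> y\<close> by (cases "s = x"; cases "x = y") (auto simp: primitive_from_def)
  next
    case 2
    then show ?thesis using eq[of x s y] by (cases "s = y") (auto simp: primitive_from_def)
  next
    case 3
    then show ?thesis using eq[of x y s] \<open>x \<le> y\<close> by (auto simp: primitive_from_def)
  qed
qed

lemma primitive_from_lipschitz:
  assumes int: "\<And>x y. \<phi> integrable_on {x..y}" and bound: "\<And>t. \<bar>\<phi> t\<bar> \<le> m"
  shows "\<bar>primitive_from s \<phi> y - primitive_from s \<phi> x\<bar> \<le> m * \<bar>y - x\<bar>"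
proof -
  have le: "\<bar>primitive_from s \<phi> y - primitive_from s \<phi> x\<bar> \<le> m * (y - x)" if "x \<le> y" for x y
  proof -
    have "norm (integral {x..y} \<phi>) \<le> integral {x..y} (\<lambda>_. m)"
      using int bound by (intro Henstock_Kurzweil_Integration.integral_norm_bound_integral) auto
    then show ?thesis using that by (simp add: primitive_from_diff[OF int] mult.commute)
  qed
  show ?thesis using le[of x y] le[of y x] by (cases "x \<le> y") (auto simp: abs_minus_commute)
qed

text \<open>Integrating the exponential weight away from \<open>s\<close> reproduces it up to the
  factor \<open>1 / \<kappa>\<close>. This factor is what turns the Picard operator into a
  contraction on the whole line at once.\<close>

lemma primitive_from_weighted_diff_le:
  assumes int1: "\<And>x y. \<phi> integrable_on {x..y}" and int2: "\<And>x y. \<psi> integrable_on {x..y}"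
    and bound: "\<And>t. \<bar>\<phi> t - \<psi> t\<bar> \<le> C * exp (\<kappa> * \<bar>t - s\<bar>)" and "\<kappa> > 0" "C \<ge> 0"
  shows "\<bar>primitive_from s \<phi> t - primitive_from s \<psi> t\<bar> \<le> C / \<kappa> * exp (\<kappa> * \<bar>t - s\<bar>)"
proof (cases "s \<le> t")
  case True
  have "((\<lambda>\<tau>. C * exp (\<kappa> * (\<tau> - s))) has_integral C / \<kappa> * exp (\<kappa> * (t - s)) - C / \<kappa> * exp (\<kappa> * (s - s))) {s..t}"
    using \<open>\<kappa> > 0\<close> True by (intro fundamental_theorem_of_calculus)
      (auto intro!: derivative_eq_intros simp flip: has_real_derivative_iff_has_vector_derivative)
  then have weight: "((\<lambda>\<tau>. C * exp (\<kappa> * \<bar>\<tau> - s\<bar>)) has_integral C / \<kappa> * exp (\<kappa> * (t - s)) - C / \<kappa>) {s..t}"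
    by (subst has_integral_cong[where g = "\<lambda>\<tau>. C * exp (\<kappa> * (\<tau> - s))"]) auto
  have "norm (integral {s..t} (\<lambda>\<tau>. \<phi> \<tau> - \<psi> \<tau>)) \<le> integral {s..t} (\<lambda>\<tau>. C * exp (\<kappa> * \<bar>\<tau> - s\<bar>))"
  proof (rule Henstock_Kurzweil_Integration.integral_norm_bound_integral)
    show "norm (\<phi> \<tau> - \<psi> \<tau>) \<le> C * exp (\<kappa> * \<bar>\<tau> - s\<bar>)" for \<tau> using bound[of \<tau>] by simp
  qed (use int1 int2 weight in \<open>auto intro: integrable_diff\<close>)
  also have "\<dots> \<le> C / \<kappa> * exp (\<kappa> * (t - s))"
    using integral_unique[OF weight] \<open>\<kappa> > 0\<close> \<open>C \<ge> 0\<close> by simp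
  finally show ?thesis
    using True by (cases "s = t") (auto simp: primitive_from_def Henstock_Kurzweil_Integration.integral_diff[OF int1 int2])
next
  case False
  have "((\<lambda>\<tau>. C * exp (\<kappa> * (s - \<tau>))) has_integral - C / \<kappa> * exp (\<kappa> * (s - s)) - - C / \<kappa> * exp (\<kappa> * (s - t))) {t..s}"
    using \<open>\<kappa> > 0\<close> False by (intro fundamental_theorem_of_calculus)
      (auto intro!: derivative_eq_intros simp flip: has_real_derivative_iff_has_vector_derivative)
  then have weight: "((\<lambda>\<tau>. C * exp (\<kappa> * \<bar>\<tau> - s\<bar>)) has_integral C / \<kappa> * exp (\<kappa> * (s - t)) - C / \<kappa>) {t..s}"
    by (subst has_integral_cong[where g = "\<lambda>\<tau>. C * exp (\<kappa> * (s - \<tau>))"]) auto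
  have "norm (integral {t..s} (\<lambda>\<tau>. \<phi> \<tau> - \<psi> \<tau>)) \<le> integral {t..s} (\<lambda>\<tau>. C * exp (\<kappa> * \<bar>\<tau> - s\<bar>))"
  proof (rule Henstock_Kurzweil_Integration.integral_norm_bound_integral)
    show "norm (\<phi> \<tau> - \<psi> \<tau>) \<le> C * exp (\<kappa> * \<bar>\<tau> - s\<bar>)" for \<tau> using bound[of \<tau>] by simp
  qed (use int1 int2 weight in \<open>auto intro: integrable_diff\<close>)
  also have "\<dots> \<le> C / \<kappa> * exp (\<kappa> * (s - t))"
    using integral_unique[OF weight] \<open>\<kappa> > 0\<close> \<open>C \<ge> 0\<close> by simp
  finally show ?thesis
    using False by (auto simp: primitive_from_def Henstock_Kurzweil_Integration.integral_diff[OF int1 int2])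
qed

text \<open>
  The Picard operator is a contraction for the norm weighted by \<open>exp (- 2 l \<bar>t - s\<bar>)\<close>; it acts here on
  the bounded continuous functions \<open>w t = exp (- 2 l \<bar>t - s\<bar>) * v t\<close>.
\<close>

lemma Caratheodory_global_solution:
  fixes F :: "real \<Rightarrow> real \<Rightarrow> real"
  assumes meas: "(\<lambda>(t, x). F t x) \<in> borel_measurable borel"
    and bound: "\<And>t x. \<bar>F t x\<bar> \<le> m" and lip: "\<And>t x y. \<bar>F t x - F t y\<bar> \<le> l * \<bar>x - y\<bar>" and "l > 0"
  obtains v where "solution_on F UNIV v" "v s = x0"
proof -
  have "m \<ge> 0" using bound[of 0 0] by linarith
  define E where "E t = exp (2 * l * \<bar>t - s\<bar>)" for t
  have E: "E t > 0" "continuous_on UNIV E" for t by (auto simp: E_def intro!: continuous_intros)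
  define g where "g w t = F t (E t * w t)" for w :: "real \<Rightarrow>\<^sub>C real" and t
  have int: "g w integrable_on {x..y}" for w x y
  proof (rule measurable_bounded_by_integrable_imp_integrable[where g = "\<lambda>_. m"])
    have "(\<lambda>t. (t, E t * w t)) \<in> borel_measurable borel"
      using E(2) by (intro borel_measurable_continuous_onI continuous_intros) auto
    from measurable_compose[OF this meas] have "g w \<in> borel_measurable borel"
      by (simp add: g_def[abs_def])
    then show "g w \<in> borel_measurable (lebesgue_on {x..y})"
      by (simp add: borel_measurable_if_D measurable_completion measurable_restrict_space1)
  qed (use bound in \<open>auto simp: g_def\<close>)
  define P where "P w = primitive_from s (g w)" for w
  have Plip: "\<bar>P w y - P w x\<bar> \<le> m * \<bar>y - x\<bar>" for w x y
    unfolding P_def using bound by (intro primitive_from_lipschitz int) (simp add: g_def)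
  define T0 where "T0 w t = (x0 + P w t) / E t" for w t
  have T0: "T0 w \<in> bcontfun" for w
  proof (rule bcontfun_normI)
    have "m-lipschitz_on UNIV (P w)"
      using Plip \<open>m \<ge> 0\<close> by (auto simp: lipschitz_on_def dist_real_def)
    then have "continuous_on UNIV (P w)" by (rule lipschitz_on_continuous_on)
    then show "continuous_on UNIV (T0 w)"
      unfolding T0_def using E by (intro continuous_intros) (auto simp: less_imp_neq[symmetric])
    fix t
    \<comment> \<open>The primitive of a bounded function grows at most linearly, and the weight
      dominates linear growth; so \<open>T0 w\<close> is bounded.\<close>
    have "2 * l * \<bar>t - s\<bar> \<le> E t" unfolding E_def using exp_ge_add_one_self[of "2 * l * \<bar>t - s\<bar>"] by linarith
    then have "\<bar>t - s\<bar> \<le> E t / (2 * l)" using \<open>l > 0\<close> by (simp add: field_simps)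
    then have "m * \<bar>t - s\<bar> \<le> m * (E t / (2 * l))" using \<open>m \<ge> 0\<close> by (rule mult_left_mono)
    moreover have "\<bar>P w t\<bar> \<le> m * \<bar>t - s\<bar>" using Plip[of w t s] by (simp add: P_def primitive_from_self)
    moreover have "\<bar>x0\<bar> \<le> \<bar>x0\<bar> * E t" using \<open>l > 0\<close> by (simp add: E_def mult_le_cancel_left1)
    ultimately have "\<bar>x0 + P w t\<bar> \<le> (\<bar>x0\<bar> + m / (2 * l)) * E t" by (simp add: algebra_simps)
    then show "norm (T0 w t) \<le> \<bar>x0\<bar> + m / (2 * l)"
      using E(1)[of t] by (simp add: T0_def field_simps)
  qed
  define T where "T w = Bcontfun (T0 w)" for w
  have T: "T w t = T0 w t" for w t using T0 by (simp add: T_def Bcontfun_inverse)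
  have contr: "dist (T w1) (T w2) \<le> 1 / 2 * dist w1 w2" for w1 w2
  proof (rule dist_bound)
    fix t
    \<comment> \<open>The exponent \<open>2 * l\<close> against the Lipschitz constant
      \<open>l\<close> gives the contraction factor \<open>1 / 2\<close>.\<close>
    have "\<bar>P w1 t - P w2 t\<bar> \<le> l * dist w1 w2 / (2 * l) * E t"
      unfolding P_def E_def
    proof (rule primitive_from_weighted_diff_le)
      fix t
      have "\<bar>g w1 t - g w2 t\<bar> \<le> l * \<bar>E t * w1 t - E t * w2 t\<bar>" unfolding g_def by (rule lip)
      also have "\<dots> = l * (E t * dist (w1 t) (w2 t))"
        using E(1)[of t] by (simp add: dist_real_def abs_mult flip: right_diff_distrib)
      also have "\<dots> \<le> l * (E t * dist w1 w2)"
        using E(1)[of t] \<open>l > 0\<close> by (intro mult_left_mono dist_bounded) auto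
      finally show "\<bar>g w1 t - g w2 t\<bar> \<le> l * dist w1 w2 * exp (2 * l * \<bar>t - s\<bar>)"
        by (simp add: E_def mult_ac)
    qed (use int \<open>l > 0\<close> in auto)
    also have "\<dots> = 1 / 2 * dist w1 w2 * E t" using \<open>l > 0\<close> by simp
    finally have "\<bar>P w1 t - P w2 t\<bar> / E t \<le> 1 / 2 * dist w1 w2" using E(1)[of t] by (simp add: field_simps)
    moreover have "dist (T w1 t) (T w2 t) = \<bar>P w1 t - P w2 t\<bar> / E t"
      using E(1)[of t] by (simp add: T T0_def dist_real_def flip: diff_divide_distrib)
    ultimately show "dist (T w1 t) (T w2 t) \<le> 1 / 2 * dist w1 w2" by simp
  qed
  obtain w where w: "T w = w"
    using banach_fix_type[of "1 / 2" T] contr by auto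
  define v where "v t = x0 + P w t" for t
  \<comment> \<open>At the fixed point \<open>E t * w t = x0 + P w t\<close>, so removing the weight
    turns \<open>g w\<close> into the field along \<open>v\<close>.\<close>
  have gw: "g w t = F t (v t)" for t
  proof -
    have "E t * w t = E t * T0 w t" using T[of w t] w by simp
    then show ?thesis using E(1)[of t] by (simp add: g_def v_def T0_def)
  qed
  show ?thesis
  proof (rule that)
    show "v s = x0" by (simp add: v_def P_def primitive_from_self)
    have "AE t in lebesgue. (P w has_real_derivative g w t) (at t)"
      unfolding P_def by (intro AE_has_derivative_primitive int primitive_from_diff)
    then have "AE t in lebesgue. (v has_real_derivative F t (v t)) (at t)"
      unfolding v_def[abs_def] gw[unfolded v_def] by eventually_elim (auto intro!: derivative_eq_intros)
    moreover have "abs_continuous_on_interval a b v" for a b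
      by (rule lipschitz_imp_abs_continuous_on_interval[of _ _ _ m]) (use Plip in \<open>simp add: v_def\<close>)
    ultimately show "solution_on F UNIV v" by (auto simp: solution_on_def is_interval_univ)
  qed
qed


section \<open>Solutions under the structural conditions\<close>

lemma solution_on_subset:
  assumes "solution_on g I u" "J \<subseteq> I" "is_interval J"
  shows "solution_on g J u"
  unfolding solution_on_def
proof (intro conjI allI impI)
  show "AE t in lebesgue. t \<in> J \<longrightarrow> (u has_real_derivative g t (u t)) (at t within J)"
    using assms(1) unfolding solution_on_def
    by (auto elim!: eventually_mono intro: DERIV_subset[OF _ assms(2)] subsetD[OF assms(2)])
qed (use assms in \<open>auto simp: solution_on_def\<close>)

lemma solution_on_cong_AE:
  assumes "solution_on g I u" "AE t in lebesgue. t \<in> I \<longrightarrow> g t (u t) = g' t (u t)"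
  shows "solution_on g' I u"
proof -
  have "AE t in lebesgue. t \<in> I \<longrightarrow> (u has_real_derivative g t (u t)) (at t within I)"
    using assms(1) by (simp add: solution_on_def)
  then have "AE t in lebesgue. t \<in> I \<longrightarrow> (u has_real_derivative g' t (u t)) (at t within I)"
    using assms(2) by eventually_elim auto
  then show ?thesis using assms(1) by (simp add: solution_on_def)
qed

text \<open>The null set of times may depend on \<open>M\<close> but not on the states, so the
  estimate can be inserted along any two solutions bounded by \<open>M\<close>.\<close>

definition AE_locally_lipschitz :: "(real \<Rightarrow> real \<Rightarrow> real) \<Rightarrow> bool" where
  "AE_locally_lipschitz g \<longleftrightarrow> (\<forall>M. \<exists>l. AE t in lebesgue. \<forall>x y. \<bar>x\<bar> \<le> M \<and> \<bar>y\<bar> \<le> M \<longrightarrow> \<bar>g t x - g t y\<bar> \<le> l * \<bar>x - y\<bar>)"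

text \<open>The difference satisfies
  \<open>\<bar>z'\<bar> \<le> \<bar>l0\<bar> * \<bar>z\<bar>\<close> almost everywhere, and this
  bound is symmetric in time: order passes from \<open>p\<close> to \<open>q\<close> on either side.
  Used in both orders it gives uniqueness, and by contraposition it preserves strict order.\<close>

lemma solution_on_mono:
  assumes lip: "AE_locally_lipschitz g"
    and u: "solution_on g {\<alpha>..\<beta>} u" and v: "solution_on g {\<alpha>..\<beta>} v"
    and pq: "p \<in> {\<alpha>..\<beta>}" "q \<in> {\<alpha>..\<beta>}" and le: "u p \<le> v p"
  shows "u q \<le> v q"
proof -
  have ac: "abs_continuous_on_interval \<alpha> \<beta> u" "abs_continuous_on_interval \<alpha> \<beta> v"
    using u v pq by (auto simp: solution_on_def)
  have "bounded (u ` {\<alpha>..\<beta>} \<union> v ` {\<alpha>..\<beta>})"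
    using ac by (intro compact_imp_bounded compact_Un compact_continuous_image)
      (auto intro: abs_continuous_on_interval_imp_continuous_on)
  then obtain M where "\<forall>x\<in>u ` {\<alpha>..\<beta>} \<union> v ` {\<alpha>..\<beta>}. norm x \<le> M" unfolding bounded_iff by blast
  then have M: "\<bar>u t\<bar> \<le> M \<and> \<bar>v t\<bar> \<le> M" if "t \<in> {\<alpha>..\<beta>}" for t using that by auto
  obtain l0 where l0: "AE t in lebesgue. \<forall>x y. \<bar>x\<bar> \<le> M \<and> \<bar>y\<bar> \<le> M \<longrightarrow> \<bar>g t x - g t y\<bar> \<le> l0 * \<bar>x - y\<bar>"
    using lip by (auto simp: AE_locally_lipschitz_def)
  define z where "z t = u t - v t" for t
  have der: "AE t in lebesgue. t \<in> {\<alpha>..\<beta>} \<longrightarrow>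
      (\<exists>D. (z has_real_derivative D) (at t within {\<alpha>..\<beta>}) \<and> \<bar>D\<bar> \<le> \<bar>l0\<bar> * \<bar>z t\<bar>)"
  proof -
    have "AE t in lebesgue. t \<in> {\<alpha>..\<beta>} \<longrightarrow> (u has_real_derivative g t (u t)) (at t within {\<alpha>..\<beta>})"
      "AE t in lebesgue. t \<in> {\<alpha>..\<beta>} \<longrightarrow> (v has_real_derivative g t (v t)) (at t within {\<alpha>..\<beta>})"
      using u v by (auto simp: solution_on_def)
    then show ?thesis using l0
    proof eventually_elim
      case (elim t)
      have "\<bar>g t (u t) - g t (v t)\<bar> \<le> \<bar>l0\<bar> * \<bar>z t\<bar>" if "t \<in> {\<alpha>..\<beta>}"
      proof -
        have "\<bar>g t (u t) - g t (v t)\<bar> \<le> l0 * \<bar>u t - v t\<bar>" using elim(3) M[OF that] by blast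
        also have "\<dots> \<le> \<bar>l0\<bar> * \<bar>u t - v t\<bar>" by (intro mult_right_mono) auto
        finally show ?thesis by (simp add: z_def)
      qed
      then show ?case using elim(1,2) unfolding z_def[abs_def] by (blast intro: DERIV_diff)
    qed
  qed
  have sub: "abs_continuous_on_interval c d z"
    "AE t in lebesgue. t \<in> {c..d} \<longrightarrow> (\<exists>D. (z has_real_derivative D) (at t within {c..d}) \<and> \<bar>D\<bar> \<le> \<bar>l0\<bar> * \<bar>z t\<bar>)"
    if cd: "{c..d} \<subseteq> {\<alpha>..\<beta>}" for c d
  proof -
    show "abs_continuous_on_interval c d z" unfolding z_def[abs_def]
      using ac cd by (intro abs_continuous_on_interval_diff) (auto intro: abs_continuous_on_interval_subset)
    show "AE t in lebesgue. t \<in> {c..d} \<longrightarrow> (\<exists>D. (z has_real_derivative D) (at t within {c..d}) \<and> \<bar>D\<bar> \<le> \<bar>l0\<bar> * \<bar>z t\<bar>)"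
      using der by eventually_elim (use cd in \<open>blast intro: DERIV_subset[OF _ cd]\<close>)
  qed
  have "z q \<le> 0"
  proof (cases "p \<le> q")
    case True
    have der': "AE t in lebesgue. t \<in> {p..q} \<and> 0 < z t \<longrightarrow>
        (\<exists>D\<le>\<bar>l0\<bar> * z t. (z has_real_derivative D) (at t within {p..q}))"
    proof -
      have "{p..q} \<subseteq> {\<alpha>..\<beta>}" using pq by auto
      from sub(2)[OF this] show ?thesis by eventually_elim (force simp: abs_le_iff)
    qed
    show ?thesis
      by (rule comparison_forward[OF True sub(1) _ abs_ge_zero der']) (use pq le in \<open>auto simp: z_def\<close>)
  next
    case False
    have der': "AE t in lebesgue. t \<in> {q..p} \<and> 0 < z t \<longrightarrow>
        (\<exists>D\<ge>- \<bar>l0\<bar> * z t. (z has_real_derivative D) (at t within {q..p}))"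
    proof -
      have "{q..p} \<subseteq> {\<alpha>..\<beta>}" using pq by auto
      from sub(2)[OF this] show ?thesis
      proof eventually_elim
        case (elim t)
        show ?case
        proof
          assume t: "t \<in> {q..p} \<and> 0 < z t"
          then obtain D where D: "(z has_real_derivative D) (at t within {q..p})" "\<bar>D\<bar> \<le> \<bar>l0\<bar> * \<bar>z t\<bar>"
            using elim by blast
          have "- \<bar>l0\<bar> * z t \<le> D" using D(2) t by (simp add: abs_le_iff)
          with D(1) show "\<exists>D\<ge>- \<bar>l0\<bar> * z t. (z has_real_derivative D) (at t within {q..p})" by blast
        qed
      qed
    qed
    show ?thesis
      by (rule comparison_backward[OF _ sub(1) _ abs_ge_zero der']) (use False pq le in \<open>auto simp: z_def\<close>)
  qed
  then show ?thesis by (simp add: z_def)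
qed

lemma solution_on_UNIV_mono:
  assumes "AE_locally_lipschitz g" "solution_on g UNIV u" "solution_on g UNIV v" "u p \<le> v p"
  shows "u q \<le> v q"
  using solution_on_mono[of g "min p q" "max p q" u v p q] assms
  by (auto intro: solution_on_subset is_interval_cc)

section \<open>Almost everywhere bounds on the field and truncation in the state\<close>

lemma cond_f2_AE_bounded:
  assumes "cond_f2 f"
  obtains m where "AE t in lebesgue. \<forall>x. \<bar>x\<bar> \<le> M \<longrightarrow> \<bar>f t x\<bar> \<le> m"
proof -
  obtain j :: nat where j: "M \<le> real j" using real_arch_simple by blast
  obtain m where m: "AE t in lebesgue. (SUP x\<in>{- real j..real j}. ereal \<bar>f t x\<bar>) \<le> ereal m"
    using assms unfolding cond_f2_def by blast
  have "AE t in lebesgue. \<forall>x. \<bar>x\<bar> \<le> M \<longrightarrow> \<bar>f t x\<bar> \<le> m"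
    using m
  proof eventually_elim
    case (elim t)
    have "\<bar>f t x\<bar> \<le> m" if "\<bar>x\<bar> \<le> M" for x
    proof -
      have "x \<in> {- real j..real j}" using that j by auto
      then show ?thesis using elim unfolding SUP_le_iff by (auto dest: bspec[of _ _ x])
    qed
    then show ?case by blast
  qed
  then show ?thesis by (rule that)
qed

lemma cond_f3_AE_locally_lipschitz:
  assumes "cond_f3 f"
  shows "AE_locally_lipschitz f"
  unfolding AE_locally_lipschitz_def
proof
  fix M :: real
  obtain j :: nat where j: "M \<le> real j" using real_arch_simple by blast
  obtain l where l: "AE t in lebesgue.
      (SUP (x1, x2)\<in>distinct_pairs j. ereal (\<bar>f t x2 - f t x1\<bar> / \<bar>x2 - x1\<bar>)) \<le> ereal l"
    using assms unfolding cond_f3_def by blast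
  have "AE t in lebesgue. \<forall>x y. \<bar>x\<bar> \<le> M \<and> \<bar>y\<bar> \<le> M \<longrightarrow> \<bar>f t x - f t y\<bar> \<le> l * \<bar>x - y\<bar>"
    using l
  proof eventually_elim
    case (elim t)
    have "\<bar>f t x - f t y\<bar> \<le> l * \<bar>x - y\<bar>" if "\<bar>x\<bar> \<le> M" "\<bar>y\<bar> \<le> M" for x y
    proof (cases "x = y")
      case False
      then have "(y, x) \<in> distinct_pairs j" using that j by (auto simp: distinct_pairs_def)
      then have "\<bar>f t x - f t y\<bar> / \<bar>x - y\<bar> \<le> l" using elim unfolding SUP_le_iff by force
      then show ?thesis using False by (simp add: pos_divide_le_eq)
    qed simp
    then show ?case by blast
  qed
  then show "\<exists>l. AE t in lebesgue. \<forall>x y. \<bar>x\<bar> \<le> M \<and> \<bar>y\<bar> \<le> M \<longrightarrow> \<bar>f t x - f t y\<bar> \<le> l * \<bar>x - y\<bar>" by blast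
qed

text \<open>The supremum over \<open>R\<close> stands inside the upper limit, so a single threshold
  \<open>X\<close> works for almost every time. Large constants of either sign thereby become
  barriers.\<close>

lemma cond_f6_AE_negative:
  assumes "cond_f6 f"
  obtains X where "AE t in lebesgue. \<forall>x. X \<le> \<bar>x\<bar> \<longrightarrow> f t x < 0"
proof -
  obtain R \<delta> where R: "- R \<in> null_sets lebesgue" and "\<delta> > 0"
    and top: "Limsup at_top (\<lambda>x. SUP t\<in>R. ereal (f t x / x\<^sup>2)) < ereal (- \<delta>)"
    and bot: "Limsup at_bot (\<lambda>x. SUP t\<in>R. ereal (f t x / x\<^sup>2)) < ereal (- \<delta>)"
    using assms unfolding cond_f6_def by blast
  obtain X1 where X1: "\<And>x. x \<ge> X1 \<Longrightarrow> (SUP t\<in>R. ereal (f t x / x\<^sup>2)) < ereal (- \<delta>)"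
    using Limsup_lessD[OF top] by (auto simp: eventually_at_top_linorder)
  obtain X2 where X2: "\<And>x. x \<le> X2 \<Longrightarrow> (SUP t\<in>R. ereal (f t x / x\<^sup>2)) < ereal (- \<delta>)"
    using Limsup_lessD[OF bot] by (auto simp: eventually_at_bot_linorder)
  have "AE t in lebesgue. t \<in> R" using AE_not_in[OF R] by simp
  then have "AE t in lebesgue. \<forall>x. max X1 (- X2) \<le> \<bar>x\<bar> \<longrightarrow> f t x < 0"
  proof eventually_elim
    case (elim t)
    have "f t x < 0" if "max X1 (- X2) \<le> \<bar>x\<bar>" for x
    proof -
      have "(SUP t\<in>R. ereal (f t x / x\<^sup>2)) < ereal (- \<delta>)" using X1[of x] X2[of x] that by (cases "x \<ge> 0") auto
      moreover have "ereal (f t x / x\<^sup>2) \<le> (SUP t\<in>R. ereal (f t x / x\<^sup>2))" using elim by (intro SUP_upper)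
      ultimately have "ereal (f t x / x\<^sup>2) < ereal (- \<delta>)" by (rule order.strict_trans1[rotated])
      then have "f t x / x\<^sup>2 < 0" using \<open>\<delta> > 0\<close> by simp
      then show ?thesis by (simp add: divide_less_0_iff)
    qed
    then show ?case by blast
  qed
  then show ?thesis by (rule that)
qed

text \<open>The state is clamped to \<open>[-M, M]\<close>, which makes the field globally bounded
  and Lipschitz and so gives global solutions; those that stay in the range solve the original
  equation. The bounds hold at every time, as the existence result requires, while agreement with
  \<open>f\<close> is only almost everywhere.\<close>

locale truncation =
  fixes f F :: "real \<Rightarrow> real \<Rightarrow> real" and M m l :: real
  assumes M_nonneg: "M \<ge> 0" and l_pos: "l > 0"
    and meas: "(\<lambda>(t, x). F t x) \<in> borel_measurable borel"
    and bound: "\<And>t x. \<bar>F t x\<bar> \<le> m"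
    and lip: "\<And>t x y. \<bar>F t x - F t y\<bar> \<le> l * \<bar>x - y\<bar>"
    and trunc: "AE t in lebesgue. \<forall>x. F t x = f t (max (- M) (min M x))"
begin

lemma AE_locally_lipschitz: "AE_locally_lipschitz F"
  unfolding AE_locally_lipschitz_def by (intro allI exI[of _ l] AE_I2) (use lip in auto)

lemma solution_truncated_iff:
  assumes "\<And>t. t \<in> I \<Longrightarrow> \<bar>u t\<bar> \<le> M"
  shows "solution_on F I u \<longleftrightarrow> solution_on f I u"
proof -
  have eq: "max (- M) (min M (u t)) = u t" if "t \<in> I" for t using assms[OF that] by auto
  have "AE t in lebesgue. t \<in> I \<longrightarrow> F t (u t) = f t (u t)" using trunc by eventually_elim (metis eq)
  then show ?thesis
    by (auto intro: solution_on_cong_AE[of F I u f] solution_on_cong_AE[of f I u F] elim: eventually_mono)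
qed

lemma bounded_solution_truncated:
  assumes "bounded_solution f u" "\<And>t. \<bar>u t\<bar> \<le> M"
  shows "solution_on F UNIV u"
  using assms by (simp add: solution_truncated_iff bounded_solution_def)

lemma solution_exists:
  obtains v where "solution_on F UNIV v" "v s = x0"
  using Caratheodory_global_solution[OF meas bound lip l_pos] .

text \<open>Above \<open>M\<close> the truncated field is \<open>f t M < 0\<close>, so the excess
  over \<open>M\<close> cannot grow and the comparison applies with rate 0.\<close>

lemma truncated_solution_le_forward:
  assumes v: "solution_on F UNIV v" and "v s \<le> M" and neg: "AE t in lebesgue. f t M < 0" and "s \<le> t"
  shows "v t \<le> M"
proof -
  have "v t - M \<le> 0"
  proof (rule comparison_forward[OF \<open>s \<le> t\<close>, where L = 0])
    show "abs_continuous_on_interval s t (\<lambda>t. v t - M)"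
      using v \<open>s \<le> t\<close> by (intro abs_continuous_on_interval_diff abs_continuous_on_interval_const) (simp add: solution_on_def)
    have "AE \<tau> in lebesgue. (v has_real_derivative F \<tau> (v \<tau>)) (at \<tau>)" using v by (simp add: solution_on_def)
    then show "AE \<tau> in lebesgue. \<tau> \<in> {s..t} \<and> 0 < v \<tau> - M \<longrightarrow>
        (\<exists>D\<le>0 * (v \<tau> - M). ((\<lambda>t. v t - M) has_real_derivative D) (at \<tau> within {s..t}))"
      using neg trunc
    proof eventually_elim
      case (elim \<tau>)
      have "((\<lambda>t. v t - M) has_real_derivative F \<tau> (v \<tau>)) (at \<tau> within {s..t})"
        using has_field_derivative_at_within[OF DERIV_diff[OF elim(1) DERIV_const]] by simp
      moreover have "F \<tau> (v \<tau>) \<le> 0" if "M < v \<tau>" using elim(2,3) that M_nonneg by (simp add: max_def min_def)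
      ultimately show ?case by auto
    qed
  qed (use assms in auto)
  then show ?thesis by simp
qed

text \<open>Below \<open>- M\<close> the field is again negative, so \<open>v\<close> rises when
  time runs backward. The common sign at both levels is why the upper barrier protects the future
  and the lower one the past.\<close>

lemma truncated_solution_ge_backward:
  assumes v: "solution_on F UNIV v" and "- M \<le> v s" and neg: "AE t in lebesgue. f t (- M) < 0" and "t \<le> s"
  shows "- M \<le> v t"
proof -
  have "- M - v t \<le> 0"
  proof (rule comparison_backward[OF \<open>t \<le> s\<close>, where L = 0])
    show "abs_continuous_on_interval t s (\<lambda>t. - M - v t)"
      using v \<open>t \<le> s\<close> by (intro abs_continuous_on_interval_diff abs_continuous_on_interval_const) (simp add: solution_on_def)
    have "AE \<tau> in lebesgue. (v has_real_derivative F \<tau> (v \<tau>)) (at \<tau>)" using v by (simp add: solution_on_def)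
    then show "AE \<tau> in lebesgue. \<tau> \<in> {t..s} \<and> 0 < - M - v \<tau> \<longrightarrow>
        (\<exists>D\<ge>- 0 * (- M - v \<tau>). ((\<lambda>t. - M - v t) has_real_derivative D) (at \<tau> within {t..s}))"
      using neg trunc
    proof eventually_elim
      case (elim \<tau>)
      have "((\<lambda>t. - M - v t) has_real_derivative - F \<tau> (v \<tau>)) (at \<tau> within {t..s})"
        using has_field_derivative_at_within[OF DERIV_diff[OF DERIV_const elim(1)]] by simp
      moreover have "F \<tau> (v \<tau>) \<le> 0" if "v \<tau> < - M" using elim(2,3) that M_nonneg by (simp add: max_def min_def)
      ultimately show ?case by (intro impI exI[of _ "- F \<tau> (v \<tau>)"]) auto
    qed
  qed (use assms in auto)
  then show ?thesis by simp
qed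

end

lemma truncation_exists:
  assumes "cond_f1 f" "cond_f2 f" "cond_f3 f" "M \<ge> 0"
  obtains F m l where "truncation f F M m l"
proof -
  define cl where "cl x = max (- M) (min M x)" for x
  have cl: "\<bar>cl x\<bar> \<le> M" "\<bar>cl x - cl y\<bar> \<le> \<bar>x - y\<bar>" for x y using \<open>M \<ge> 0\<close> by (auto simp: cl_def)
  obtain m where m: "AE t in lebesgue. \<forall>x. \<bar>x\<bar> \<le> M \<longrightarrow> \<bar>f t x\<bar> \<le> m"
    using cond_f2_AE_bounded[OF assms(2)] by blast
  obtain l where l: "AE t in lebesgue. \<forall>x y. \<bar>x\<bar> \<le> M \<and> \<bar>y\<bar> \<le> M \<longrightarrow> \<bar>f t x - f t y\<bar> \<le> l * \<bar>x - y\<bar>"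
    using cond_f3_AE_locally_lipschitz[OF assms(3)] by (auto simp: AE_locally_lipschitz_def)
  define good where "good t \<longleftrightarrow> (\<forall>x. \<bar>x\<bar> \<le> M \<longrightarrow> \<bar>f t x\<bar> \<le> m) \<and>
      (\<forall>x y. \<bar>x\<bar> \<le> M \<and> \<bar>y\<bar> \<le> M \<longrightarrow> \<bar>f t x - f t y\<bar> \<le> l * \<bar>x - y\<bar>)" for t
  have "AE t in lebesgue. good t" using m l by eventually_elim (simp add: good_def)
  \<comment> \<open>Passing from the completed measure to \<open>lborel\<close> yields a Borel null
    set \<open>N\<close>, so that changing the field on \<open>N\<close> preserves Borel
    measurability.\<close>
  then have "AE t in lborel. good t" by (simp only: AE_completion_iff)
  then obtain N where N: "N \<in> null_sets lborel" "{t \<in> space lborel. \<not> good t} \<subseteq> N"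
    unfolding eventually_ae_filter by blast
  have "good t" if "t \<notin> N" for t using N(2) that by auto
  then have good: "\<And>t x. t \<notin> N \<Longrightarrow> \<bar>x\<bar> \<le> M \<Longrightarrow> \<bar>f t x\<bar> \<le> m"
      "\<And>t x y. t \<notin> N \<Longrightarrow> \<bar>x\<bar> \<le> M \<Longrightarrow> \<bar>y\<bar> \<le> M \<Longrightarrow> \<bar>f t x - f t y\<bar> \<le> l * \<bar>x - y\<bar>"
    by (auto simp: good_def)
  define F where "F t x = (if t \<in> N then 0 else f t (cl x))" for t x
  have "truncation f F M \<bar>m\<bar> (\<bar>l\<bar> + 1)"
  proof
    have N': "N \<in> sets borel" using null_setsD2[OF N(1)] by simp
    have "(\<lambda>p. (fst p, cl (snd p))) \<in> borel_measurable (borel :: (real \<times> real) measure)"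
      unfolding cl_def by (intro borel_measurable_continuous_onI continuous_intros)
    from measurable_compose[OF this assms(1)[unfolded cond_f1_def]]
    have "(\<lambda>p. f (fst p) (cl (snd p))) \<in> borel_measurable borel" by simp
    moreover have "fst -` N \<in> sets (borel :: (real \<times> real) measure)"
      using measurable_sets[OF borel_measurable_continuous_onI[OF continuous_on_fst[OF continuous_on_id]] N']
      by (simp add: id_def)
    ultimately have "(\<lambda>p. if p \<in> fst -` N then 0 else f (fst p) (cl (snd p))) \<in> borel_measurable borel"
      by (intro measurable_If_set) auto
    then show "(\<lambda>(t, x). F t x) \<in> borel_measurable borel"
      by (simp add: F_def split_def)
    show "\<bar>F t x\<bar> \<le> \<bar>m\<bar>" for t x using good(1)[of t "cl x"] cl by (auto simp: F_def)
    show "\<bar>F t x - F t y\<bar> \<le> (\<bar>l\<bar> + 1) * \<bar>x - y\<bar>" for t x y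
    proof (cases "t \<in> N")
      case False
      have "\<bar>F t x - F t y\<bar> \<le> l * \<bar>cl x - cl y\<bar>" using good(2)[of t "cl x" "cl y"] cl False by (auto simp: F_def)
      also have "\<dots> \<le> (\<bar>l\<bar> + 1) * \<bar>x - y\<bar>" using cl(2)[of x y] by (intro mult_mono) auto
      finally show ?thesis .
    qed (simp add: F_def)
    have "AE t in lebesgue. t \<notin> N" using N(1) by (intro AE_completion AE_not_in)
    then show "AE t in lebesgue. \<forall>x. F t x = f t (max (- M) (min M x))"
      by eventually_elim (simp add: F_def cl_def)
  qed (use \<open>M \<ge> 0\<close> in auto)
  then show ?thesis by (rule that)
qed


section \<open>Piecewise constant transitions\<close>

lemma bounded_solution_bound:
  assumes "bounded_solution g u"
  obtains K where "\<And>t. \<bar>u t\<bar> \<le> K"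
  using assms by (auto simp: bounded_solution_def bounded_iff)

text \<open>The truncated solution through \<open>x0\<close> is trapped between \<open>r\<close> and
  \<open>a\<close>, so it is global and solves the original equation. Every maximal solution through
  the same point agrees with it on its domain, so the description in \<open>sol\<close> denotes its
  value.\<close>

lemma solution_between:
  assumes f: "cond_f1 f" "cond_f2 f" "cond_f3 f"
    and a: "bounded_solution f a" and r: "bounded_solution f r"
    and x0: "r s \<le> x0" "x0 \<le> a s"
  shows "\<exists>v. solution_on f UNIV v \<and> v s = x0 \<and> (\<forall>t. sol f t s x0 = v t)"
proof -
  obtain Ka where Ka: "\<And>t. \<bar>a t\<bar> \<le> Ka" using bounded_solution_bound[OF a] by blast
  obtain Kr where Kr: "\<And>t. \<bar>r t\<bar> \<le> Kr" using bounded_solution_bound[OF r] by blast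
  define M where "M = max Ka Kr"
  have M: "\<bar>a t\<bar> \<le> M" "\<bar>r t\<bar> \<le> M" for t using Ka[of t] Kr[of t] by (auto simp: M_def)
  then have "M \<ge> 0" using abs_ge_zero order_trans by blast
  then obtain F m l where "truncation f F M m l" using truncation_exists f by blast
  then interpret truncation f F M m l .
  obtain v where v: "solution_on F UNIV v" "v s = x0" using solution_exists by blast
  have "r t \<le> v t" "v t \<le> a t" for t
    using solution_on_UNIV_mono[OF AE_locally_lipschitz _ _, of r v s t]
      solution_on_UNIV_mono[OF AE_locally_lipschitz _ _, of v a s t]
      bounded_solution_truncated[OF a M(1)] bounded_solution_truncated[OF r M(2)] v x0 by auto
  then have "\<bar>v t\<bar> \<le> M" for t using M(1)[of t] M(2)[of t] by (smt (verit))
  then have vf: "solution_on f UNIV v" using v(1) by (simp add: solution_truncated_iff)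
  have uniq: "u t = v t" if "maximal_solution f s x0 I u" "t \<in> I" for I u t
  proof -
    have u: "solution_on f I u" "s \<in> I" "u s = x0" "is_interval I"
      using that(1) by (auto simp: maximal_solution_def solution_on_def)
    have ends: "min s t \<in> I" "max s t \<in> I" using u(2) that(2) by (simp_all add: min_def max_def)
    have sub: "{min s t..max s t} \<subseteq> I"
    proof
      fix x assume "x \<in> {min s t..max s t}"
      then show "x \<in> I" using mem_is_interval_1_I[OF u(4) ends, of x] by (simp only: atLeastAtMost_iff)
    qed
    then have "solution_on f {min s t..max s t} u" "solution_on f {min s t..max s t} v"
      using solution_on_subset[OF u(1) sub is_interval_cc] solution_on_subset[OF vf subset_UNIV is_interval_cc] by auto
    then show ?thesis
      using solution_on_mono[OF cond_f3_AE_locally_lipschitz[OF f(3)], of "min s t" "max s t" _ _ s t] u(3) v(2)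
      by (intro antisym) auto
  qed
  have maxi: "maximal_solution f s x0 UNIV v"
    using vf v(2) by (auto simp: maximal_solution_def)
  have "sol f t s x0 = v t" for t
    unfolding sol_def
  proof (rule the_equality)
    show "\<exists>I u. maximal_solution f s x0 I u \<and> t \<in> I \<and> v t = u t" using maxi by blast
  qed (use uniq in blast)
  then show ?thesis using vf v(2) by blast
qed

locale step_solution =
  fixes f :: "real \<Rightarrow> real \<Rightarrow> real" and \<Gamma> u :: "real \<Rightarrow> real" and h G :: real
  assumes f1: "cond_f1 f" and f2: "cond_f2 f" and f3: "cond_f3 f" and f6: "cond_f6 f"
    and h_pos: "h > 0" and mono: "mono \<Gamma>" and \<Gamma>_bound: "\<And>t. \<bar>\<Gamma> t\<bar> \<le> G"
    and u: "bounded_solution (\<lambda>t x. f t (x - step_transition \<Gamma> h t)) u"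
begin

text \<open>The step function has already jumped at the right endpoint, but this is one point of
  measure zero. Having the closed interval lets consecutive pieces be compared at their common grid
  point.\<close>

lemma piece_solution:
  "solution_on f {of_int j * h..of_int (j + 1) * h} (\<lambda>t. u t - \<Gamma> (of_int j * h))"
  (is "solution_on f ?I ?y")
  unfolding solution_on_def
proof (intro conjI allI impI)
  show "abs_continuous_on_interval a b ?y" if "a \<le> b \<and> {a..b} \<subseteq> ?I" for a b
    using u that by (intro abs_continuous_on_interval_diff abs_continuous_on_interval_const)
      (auto simp: bounded_solution_def solution_on_def)
  have "AE t in lebesgue. (u has_real_derivative f t (u t - step_transition \<Gamma> h t)) (at t)"
    using u by (simp add: bounded_solution_def solution_on_def)
  then show "AE t in lebesgue. t \<in> ?I \<longrightarrow> (?y has_real_derivative f t (?y t)) (at t within ?I)"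
    using AE_lebesgue_neq[of "of_int (j + 1) * h"]
  proof eventually_elim
    case (elim t)
    have "(?y has_real_derivative f t (u t - step_transition \<Gamma> h t)) (at t within ?I)"
      using has_field_derivative_at_within[OF DERIV_diff[OF elim(1) DERIV_const]] by simp
    moreover have "step_transition \<Gamma> h t = \<Gamma> (of_int j * h)" if "t \<in> ?I"
      using that elim(2) h_pos by (intro step_transition_eq) auto
    ultimately show ?case by auto
  qed
qed (simp add: is_interval_cc)

text \<open>The times \<open>t\<close> and \<open>t'\<close> are independent so that the level
  covers \<open>u - \<Gamma>\<close> at a grid point with the value of \<Gamma> from before the jump
  as well as from after it.\<close>

lemma truncation_level:
  assumes "bounded_solution f b"
  shows "\<exists>M\<ge>0. (\<forall>t. \<bar>b t\<bar> \<le> M) \<and> (\<forall>t t'. \<bar>u t - \<Gamma> t'\<bar> \<le> M) \<and>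
    (AE t in lebesgue. f t M < 0) \<and> (AE t in lebesgue. f t (- M) < 0)"
proof -
  obtain Kb where Kb: "\<And>t. \<bar>b t\<bar> \<le> Kb" using bounded_solution_bound[OF assms] by blast
  obtain Ku where Ku: "\<And>t. \<bar>u t\<bar> \<le> Ku" using bounded_solution_bound[OF u] by blast
  obtain X where X: "AE t in lebesgue. \<forall>x. X \<le> \<bar>x\<bar> \<longrightarrow> f t x < 0"
    using cond_f6_AE_negative[OF f6] by blast
  define M where "M = Max {0, Kb, Ku + G, X}"
  have M: "0 \<le> M" "Kb \<le> M" "Ku + G \<le> M" "X \<le> M" by (auto simp: M_def)
  have "\<bar>b t\<bar> \<le> M" for t using Kb[of t] M by linarith
  moreover have "\<bar>u t - \<Gamma> t'\<bar> \<le> M" for t t' using Ku[of t] \<Gamma>_bound[of t'] M by linarith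
  moreover have "AE t in lebesgue. f t M < 0" "AE t in lebesgue. f t (- M) < 0"
    using X by (eventually_elim, use M in auto)+
  ultimately show ?thesis using M(1) by blast
qed

lemma step_mono: "\<Gamma> (of_int j * h) \<le> \<Gamma> (of_int (j + 1) * h)"
  using h_pos by (intro monoD[OF mono]) (simp add: algebra_simps)

text \<open>Were the value above \<open>b\<close>, the unperturbed solution \<open>v\<close> through
  it would stay above \<open>b\<close>. Backward in time it lies below the shifted solution, whose
  jumps read backward go up; forward in time \<open>M\<close> is a barrier. So \<open>v\<close>
  would be a bounded solution exceeding \<open>b\<close>.\<close>

lemma solution_le_upper:
  assumes b: "bounded_solution f b" and top: "\<And>v. bounded_solution f v \<Longrightarrow> \<forall>t. v t \<le> b t"
  shows "u (of_int k * h) - \<Gamma> (of_int k * h) \<le> b (of_int k * h)"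
proof (rule ccontr)
  assume above: "\<not> ?thesis"
  obtain M where "M \<ge> 0" "\<forall>t. \<bar>b t\<bar> \<le> M" "\<forall>t t'. \<bar>u t - \<Gamma> t'\<bar> \<le> M"
    and neg: "AE t in lebesgue. f t M < 0" "AE t in lebesgue. f t (- M) < 0"
    using truncation_level[OF b] by auto
  then have M: "M \<ge> 0" "\<And>t. \<bar>b t\<bar> \<le> M" "\<And>t t'. \<bar>u t - \<Gamma> t'\<bar> \<le> M" by auto
  obtain F m l where "truncation f F M m l" using truncation_exists[OF f1 f2 f3 M(1)] by blast
  then interpret truncation f F M m l .
  have piece: "solution_on F {of_int j * h..of_int (j + 1) * h} (\<lambda>t. u t - \<Gamma> (of_int j * h))" for j
    using piece_solution by (subst solution_truncated_iff) (use M in auto)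
  obtain v where v: "solution_on F UNIV v" "v (of_int k * h) = u (of_int k * h) - \<Gamma> (of_int k * h)"
    using solution_exists by blast
  have below_piece: "v t \<le> u t - \<Gamma> (of_int j * h)"
    if le: "v (of_int (j + 1) * h) \<le> u (of_int (j + 1) * h) - \<Gamma> (of_int (j + 1) * h)"
      and t: "t \<in> {of_int j * h..of_int (j + 1) * h}" for j t
  proof -
    \<comment> \<open>The piece ends with the old value of \<Gamma>, the premise uses the new one;
      monotonicity of \<Gamma> bridges the two.\<close>
    have "of_int (j + 1) * h \<in> {of_int j * h..of_int (j + 1) * h}" using h_pos by auto
    from solution_on_mono[OF AE_locally_lipschitz solution_on_subset[OF v(1) subset_UNIV is_interval_cc] piece this t]
    show ?thesis using le step_mono[of j] by linarith
  qed
  have grid: "v (of_int (k - int i) * h) \<le> u (of_int (k - int i) * h) - \<Gamma> (of_int (k - int i) * h)" for i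
  proof (induction i)
    case (Suc i)
    then show ?case
      using below_piece[of "k - int (Suc i)" "of_int (k - int (Suc i)) * h"] h_pos by simp
  qed (simp add: v)
  have le_M: "v t \<le> M" for t
  proof (cases "of_int k * h \<le> t")
    case True
    then show ?thesis
      using truncated_solution_le_forward[OF v(1) _ neg(1) True] v(2) M(3) by (metis abs_le_D1)
  next
    case False
    define j where "j = \<lfloor>t / h\<rfloor>"
    have t: "t \<in> {of_int j * h..of_int (j + 1) * h}"
      using floor_divide_lower[OF h_pos, of t] floor_divide_upper[OF h_pos, of t] by (auto simp: j_def)
    have "of_int j * h < of_int k * h" using t False by simp
    then have "j < k" using h_pos by simp
    \<comment> \<open>The cell containing \<open>t\<close> ends at the grid point
      \<open>j + 1\<close>, which is at most \<open>k\<close> and hence reached by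
      \<open>grid\<close>.\<close>
    then have "v t \<le> u t - \<Gamma> (of_int j * h)"
      using below_piece[OF _ t] grid[of "nat (k - (j + 1))"] by simp
    then show ?thesis using M(3)[of t "of_int j * h"] by linarith
  qed
  have "b t \<le> v t" for t
    using solution_on_UNIV_mono[OF AE_locally_lipschitz bounded_solution_truncated[OF b M(2)] v(1), of "of_int k * h" t]
      above v(2) by simp
  then have bd: "\<bar>v t\<bar> \<le> M" for t using le_M[of t] M(2)[of t] by (smt (verit))
  then have "bounded_solution f v"
    using v(1) solution_truncated_iff[of UNIV v] by (auto simp: bounded_solution_def bounded_iff)
  then show False using top[of v] above v(2) by (metis)
qed

text \<open>The mirror argument: \<open>v\<close> stays below \<open>b\<close>, lies above the
  shifted solution in the future because its jumps go down, and is held by the barrier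
  \<open>- M\<close> in the past.\<close>

lemma solution_ge_lower:
  assumes b: "bounded_solution f b" and bot: "\<And>v. bounded_solution f v \<Longrightarrow> \<forall>t. b t \<le> v t"
  shows "b (of_int k * h) \<le> u (of_int k * h) - \<Gamma> (of_int k * h)"
proof (rule ccontr)
  assume below: "\<not> ?thesis"
  obtain M where "M \<ge> 0" "\<forall>t. \<bar>b t\<bar> \<le> M" "\<forall>t t'. \<bar>u t - \<Gamma> t'\<bar> \<le> M"
    and neg: "AE t in lebesgue. f t M < 0" "AE t in lebesgue. f t (- M) < 0"
    using truncation_level[OF b] by auto
  then have M: "M \<ge> 0" "\<And>t. \<bar>b t\<bar> \<le> M" "\<And>t t'. \<bar>u t - \<Gamma> t'\<bar> \<le> M" by auto
  obtain F m l where "truncation f F M m l" using truncation_exists[OF f1 f2 f3 M(1)] by blast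
  then interpret truncation f F M m l .
  have piece: "solution_on F {of_int j * h..of_int (j + 1) * h} (\<lambda>t. u t - \<Gamma> (of_int j * h))" for j
    using piece_solution by (subst solution_truncated_iff) (use M in auto)
  obtain v where v: "solution_on F UNIV v" "v (of_int k * h) = u (of_int k * h) - \<Gamma> (of_int k * h)"
    using solution_exists by blast
  have above_piece: "u t - \<Gamma> (of_int j * h) \<le> v t"
    if le: "u (of_int j * h) - \<Gamma> (of_int j * h) \<le> v (of_int j * h)"
      and t: "t \<in> {of_int j * h..of_int (j + 1) * h}" for j t
  proof -
    have "of_int j * h \<in> {of_int j * h..of_int (j + 1) * h}" using h_pos by auto
    from solution_on_mono[OF AE_locally_lipschitz piece solution_on_subset[OF v(1) subset_UNIV is_interval_cc] this t le]
    show ?thesis .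
  qed
  have grid: "u (of_int (k + int i) * h) - \<Gamma> (of_int (k + int i) * h) \<le> v (of_int (k + int i) * h)" for i
  proof (induction i)
    case (Suc i)
    then show ?case
      using above_piece[of "k + int i" "of_int (k + int i + 1) * h"] step_mono[of "k + int i"] h_pos
      by (simp add: algebra_simps)
  qed (simp add: v)
  have ge_M: "- M \<le> v t" for t
  proof (cases "t \<le> of_int k * h")
    case True
    then show ?thesis
      using truncated_solution_ge_backward[OF v(1) _ neg(2) True] v(2) M(3) by (metis abs_le_D2 minus_le_iff)
  next
    case False
    define j where "j = \<lfloor>t / h\<rfloor>"
    have t: "t \<in> {of_int j * h..of_int (j + 1) * h}" "t < of_int (j + 1) * h"
      using floor_divide_lower[OF h_pos, of t] floor_divide_upper[OF h_pos, of t] by (auto simp: j_def)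
    have "of_int k * h < of_int (j + 1) * h" using t False by linarith
    then have "k < j + 1" using h_pos of_int_less_iff mult_less_cancel_right_pos by blast
    then have "u t - \<Gamma> (of_int j * h) \<le> v t"
      using above_piece[OF _ t(1)] grid[of "nat (j - k)"] by simp
    then show ?thesis using M(3)[of t "of_int j * h"] by linarith
  qed
  have "v t \<le> b t" for t
    using solution_on_UNIV_mono[OF AE_locally_lipschitz v(1) bounded_solution_truncated[OF b M(2)], of "of_int k * h" t]
      below v(2) by simp
  then have bd: "\<bar>v t\<bar> \<le> M" for t using ge_M[of t] M(2)[of t] by (smt (verit))
  then have "bounded_solution f v"
    using v(1) solution_truncated_iff[of UNIV v] by (auto simp: bounded_solution_def bounded_iff)
  then show False using bot[of v] below v(2) by (metis)
qed

end

text \<open>Shifted states remain within \<open>M + C\<close>. This carries the comparison of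
  solutions over to the transition equation.\<close>

lemma AE_locally_lipschitz_shift:
  assumes "AE_locally_lipschitz f" "\<And>t. \<bar>c t\<bar> \<le> C"
  shows "AE_locally_lipschitz (\<lambda>t x. f t (x - c t))"
  unfolding AE_locally_lipschitz_def
proof
  fix M :: real
  obtain l where "AE t in lebesgue. \<forall>x y. \<bar>x\<bar> \<le> M + C \<and> \<bar>y\<bar> \<le> M + C \<longrightarrow> \<bar>f t x - f t y\<bar> \<le> l * \<bar>x - y\<bar>"
    using assms(1) unfolding AE_locally_lipschitz_def by blast
  then have "AE t in lebesgue. \<forall>x y. \<bar>x\<bar> \<le> M \<and> \<bar>y\<bar> \<le> M \<longrightarrow> \<bar>f t (x - c t) - f t (y - c t)\<bar> \<le> l * \<bar>x - y\<bar>"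
  proof eventually_elim
    case (elim t)
    have "\<bar>f t (x - c t) - f t (y - c t)\<bar> \<le> l * \<bar>x - y\<bar>" if "\<bar>x\<bar> \<le> M" "\<bar>y\<bar> \<le> M" for x y
    proof -
      have "\<bar>x - c t\<bar> \<le> M + C" "\<bar>y - c t\<bar> \<le> M + C" using that assms(2)[of t] by linarith+
      then show ?thesis using elim[rule_format, of "x - c t" "y - c t"] by simp
    qed
    then show ?case by blast
  qed
  then show "\<exists>l. AE t in lebesgue. \<forall>x y. \<bar>x\<bar> \<le> M \<and> \<bar>y\<bar> \<le> M \<longrightarrow> \<bar>f t (x - c t) - f t (y - c t)\<bar> \<le> l * \<bar>x - y\<bar>"
    by blast
qed

text \<open>For a single solution the two estimates bound \<open>exp J\<close> and
  \<open>exp (- J)\<close> for the same integral \<open>J\<close>. Over a long time both are at most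
  \<open>1 / 2\<close>, although their product is 1.\<close>

lemma attractor_repeller_pair_distinct: "\<not> attractor_repeller_pair g a a"
proof
  assume "attractor_repeller_pair g a a"
  then obtain k \<beta> where "k \<ge> 1" "\<beta> > 0"
    and fwd: "\<And>s t. s \<le> t \<Longrightarrow>
        exp (LINT l=ereal s..ereal t|lebesgue. state_deriv g l (a l)) \<le> k * exp (- \<beta> * (t - s))"
    and bwd: "\<And>s t. t \<le> s \<Longrightarrow>
        exp (LINT l=ereal s..ereal t|lebesgue. state_deriv g l (a l)) \<le> k * exp (\<beta> * (t - s))"
    unfolding attractor_repeller_pair_def by blast
  \<comment> \<open>Chosen so that \<open>k * exp (- (\<beta> * t)) = 1 / 2\<close>.\<close>
  define t where "t = ln (2 * k) / \<beta>"
  have "t \<ge> 0" using \<open>k \<ge> 1\<close> \<open>\<beta> > 0\<close> by (simp add: t_def)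
  define J where "J = (LINT l=ereal 0..ereal t|lebesgue. state_deriv g l (a l))"
  have rev: "(LINT l=ereal t..ereal 0|lebesgue. state_deriv g l (a l)) = - J"
    using \<open>t \<ge> 0\<close> by (cases "t = 0") (auto simp: J_def interval_lebesgue_integral_def set_lebesgue_integral_def)
  have e: "k * exp (- (\<beta> * t)) = 1 / 2"
    using \<open>\<beta> > 0\<close> \<open>k \<ge> 1\<close> by (simp add: t_def exp_minus field_simps)
  have "exp J \<le> 1 / 2" using fwd[of 0 t] \<open>t \<ge> 0\<close> e by (simp add: J_def)
  moreover have "exp (- J) \<le> 1 / 2" using bwd[of 0 t] \<open>t \<ge> 0\<close> e rev by simp
  ultimately have "exp J * exp (- J) \<le> 1 / 2 * (1 / 2)" by (intro mult_mono) auto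
  then show False by (simp flip: exp_add)
qed

theorem theorem5p10:
  fixes f :: "real \<Rightarrow> real \<Rightarrow> real"
    and a r \<Gamma> :: "real \<Rightarrow> real"
    and \<gamma>\<^sub>p \<gamma>\<^sub>m h :: real
    and j0 :: int and n :: nat and \<nu> :: "int \<Rightarrow> real"
  assumes "cond_f1 f" "cond_f2 f" "cond_f3 f" "cond_f4 f" "cond_f5 f" "cond_f6 f" "cond_f7 f"
    and "attractor_repeller_pair f a r"
    and "bounded (range \<Gamma>)" "continuous_on UNIV \<Gamma>"
    and "(\<Gamma> \<longlongrightarrow> \<gamma>\<^sub>p) at_top" "(\<Gamma> \<longlongrightarrow> \<gamma>\<^sub>m) at_bot"
    and "h > 0"
    and "mono \<Gamma>"
    and "\<nu> j0 = 1" "\<nu> (j0 + int n) = 0"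
    and "\<And>j. j \<in> {j0..j0 + int n} \<Longrightarrow> \<nu> j \<in> {0..1}"
    and "\<And>j. j \<in> {j0..j0 + int n - 1} \<Longrightarrow>
           sol f (of_int (j + 1) * h) (of_int j * h) (convex_comb a r (\<nu> j) (of_int j * h))
             - convex_comb a r (\<nu> (j + 1)) (of_int (j + 1) * h)
           \<le> \<Gamma> (of_int (j + 1) * h) - \<Gamma> (of_int j * h)"
  shows "(\<nexists>a' r'. attractor_repeller_pair (\<lambda>t x. f t (x - step_transition \<Gamma> h t)) a' r') \<and>
    ((\<exists>j\<in>{j0..j0 + int n - 1}.
        sol f (of_int (j + 1) * h) (of_int j * h) (convex_comb a r (\<nu> j) (of_int j * h))
          - convex_comb a r (\<nu> (j + 1)) (of_int (j + 1) * h)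
        < \<Gamma> (of_int (j + 1) * h) - \<Gamma> (of_int j * h)) \<longrightarrow>
     (\<nexists>u. bounded_solution (\<lambda>t x. f t (x - step_transition \<Gamma> h t)) u))"
proof -
  define g where "g = (\<lambda>t x. f t (x - step_transition \<Gamma> h t))"
  obtain G where G: "\<And>t. \<bar>\<Gamma> t\<bar> \<le> G" using assms(9) by (auto simp: bounded_iff)
  have a: "bounded_solution f a" and r: "bounded_solution f r"
    and between: "\<And>u. bounded_solution f u \<Longrightarrow> \<forall>t. r t \<le> u t \<and> u t \<le> a t"
    using assms(8) unfolding attractor_repeller_pair_def by blast+
  have ra: "r t \<le> a t" for t using between[OF a] by blast
  have lip: "AE_locally_lipschitz f" using assms(3) by (rule cond_f3_AE_locally_lipschitz)
  have step_solution: "step_solution f \<Gamma> u h G" if "bounded_solution g u" for u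
    using that G assms(1-3,6,13,14) by (simp add: step_solution_def g_def)
  define B where "B j = convex_comb a r (\<nu> j) (of_int j * h)" for j
  define T where "T = of_int (j0 + int n) * h"
  have B_between: "r (of_int j * h) \<le> B j \<and> B j \<le> a (of_int j * h)" if "j \<in> {j0..j0 + int n}" for j
  proof -
    have "\<nu> j \<ge> 0" "1 - \<nu> j \<ge> 0" using assms(17)[OF that] by auto
    then have "0 \<le> \<nu> j * (a (of_int j * h) - r (of_int j * h))"
      "0 \<le> (1 - \<nu> j) * (a (of_int j * h) - r (of_int j * h))"
      using ra by auto
    then show ?thesis by (simp add: B_def convex_comb_def algebra_simps)
  qed
  \<comment> \<open>Weak and strict order are advanced together: a strict inequality of the theorem
    starts the strict chain, and strictness at the left grid point continues it.\<close>
  have advance: "u (of_int (j + 1) * h) - \<Gamma> (of_int (j + 1) * h) \<le> B (j + 1) \<and>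
      (u (of_int j * h) - \<Gamma> (of_int j * h) < B j \<or>
       sol f (of_int (j + 1) * h) (of_int j * h) (B j) - B (j + 1) < \<Gamma> (of_int (j + 1) * h) - \<Gamma> (of_int j * h)
       \<longrightarrow> u (of_int (j + 1) * h) - \<Gamma> (of_int (j + 1) * h) < B (j + 1))"
    if u: "bounded_solution g u" and j: "j \<in> {j0..j0 + int n - 1}"
      and le: "u (of_int j * h) - \<Gamma> (of_int j * h) \<le> B j" for u j
  proof -
    interpret step_solution f \<Gamma> u h G using step_solution[OF u] .
    have "j \<in> {j0..j0 + int n}" using j by auto
    then have "r (of_int j * h) \<le> B j" "B j \<le> a (of_int j * h)" using B_between by blast+
    from solution_between[OF assms(1-3) a r this]
    obtain v where v: "solution_on f UNIV v" "v (of_int j * h) = B j"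
        "\<forall>t. sol f t (of_int j * h) (B j) = v t"
      by (elim exE conjE)
    have h1: "of_int j * h \<in> {of_int j * h..of_int (j + 1) * h}" "of_int (j + 1) * h \<in> {of_int j * h..of_int (j + 1) * h}"
      using h_pos by auto
    have vI: "solution_on f {of_int j * h..of_int (j + 1) * h} v"
      using v(1) by (rule solution_on_subset) (auto simp: is_interval_cc)
    have cmp: "u (of_int (j + 1) * h) - \<Gamma> (of_int j * h) \<le> v (of_int (j + 1) * h)"
      using solution_on_mono[OF lip piece_solution vI h1] le v(2) by simp
    \<comment> \<open>By contraposition: \<open>v\<close> at or below the shifted solution at the
      right end would be so at the left end too, by comparison backward in time.\<close>
    have scmp: "u (of_int (j + 1) * h) - \<Gamma> (of_int j * h) < v (of_int (j + 1) * h)"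
      if "u (of_int j * h) - \<Gamma> (of_int j * h) < B j"
      using solution_on_mono[OF lip vI piece_solution h1(2,1)] that v(2) by force
    \<comment> \<open>The excess of \<open>v\<close> over \<open>B (j + 1)\<close> is at most the
      jump of \<Gamma> at the right end, which is exactly what passing to the new value of \<Gamma>
      subtracts in \<open>cmp\<close> and \<open>scmp\<close>.\<close>
    have "v (of_int (j + 1) * h) - B (j + 1) \<le> \<Gamma> (of_int (j + 1) * h) - \<Gamma> (of_int j * h)"
      using assms(18)[OF j] v(3) by (simp add: B_def)
    then show ?thesis using cmp scmp v(3) by auto
  qed
  have start: "u (of_int j0 * h) - \<Gamma> (of_int j0 * h) \<le> B j0" if u: "bounded_solution g u" for u
  proof -
    interpret step_solution f \<Gamma> u h G using step_solution[OF u] .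
    show ?thesis
      using solution_le_upper[OF a, of j0] between assms(15) by (simp add: B_def convex_comb_def)
  qed
  have chain: "u (of_int (j0 + int i) * h) - \<Gamma> (of_int (j0 + int i) * h) \<le> B (j0 + int i)"
    if u: "bounded_solution g u" and "i \<le> n" for u i
    using \<open>i \<le> n\<close>
  proof (induction i)
    case (Suc i)
    then show ?case using advance[OF u, of "j0 + int i"] by (simp add: add.assoc add.commute[of 1])
  qed (use start[OF u] in simp)
  have lower: "r T \<le> u T - \<Gamma> T" if u: "bounded_solution g u" for u
  proof -
    interpret step_solution f \<Gamma> u h G using step_solution[OF u] .
    show ?thesis unfolding T_def using solution_ge_lower[OF r] between by blast
  qed
  have B_end: "B (j0 + int n) = r T" using assms(16) by (simp add: B_def convex_comb_def T_def)
  \<comment> \<open>At the end of the chain the upper bound \<open>B\<close> has come down to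
    \<open>r\<close>, which is also the lower bound.\<close>
  have at_T: "u T = r T + \<Gamma> T" if u: "bounded_solution g u" for u
    using chain[OF u order_refl] lower[OF u] B_end by (simp add: T_def)
  have no_pair: "\<not> attractor_repeller_pair g a' r'" for a' r'
  proof
    assume pair: "attractor_repeller_pair g a' r'"
    then have a': "bounded_solution g a'" and r': "bounded_solution g r'"
      unfolding attractor_repeller_pair_def by blast+
    have "AE_locally_lipschitz g"
      unfolding g_def using lip G by (intro AE_locally_lipschitz_shift[where C = G]) (simp_all add: step_transition_def)
    \<comment> \<open>Both solutions take the value \<open>r T + \<Gamma> T\<close> at
      \<open>T\<close>; comparison in both orders then identifies them at all times.\<close>
    then have "a' t \<le> r' t" "r' t \<le> a' t" for t
      using solution_on_UNIV_mono[of g a' r' T t] solution_on_UNIV_mono[of g r' a' T t] a' r' at_T[OF a'] at_T[OF r']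
      by (auto simp: bounded_solution_def)
    then have "a' = r'" by (intro ext antisym)
    then show False using pair attractor_repeller_pair_distinct by blast
  qed
  have no_bounded: "\<not> bounded_solution g u"
    if j: "j \<in> {j0..j0 + int n - 1}" and strict:
      "sol f (of_int (j + 1) * h) (of_int j * h) (B j) - B (j + 1) < \<Gamma> (of_int (j + 1) * h) - \<Gamma> (of_int j * h)"
    for j u
  proof
    assume u: "bounded_solution g u"
    define i0 where "i0 = nat (j - j0)"
    have i0: "j = j0 + int i0" "Suc i0 \<le> n" using j by (auto simp: i0_def)
    \<comment> \<open>Strictness arises at the right end of the strict cell, hence from index
      \<open>Suc i0\<close> on, and persists up to \<open>n\<close>, where it contradicts
      \<open>lower\<close>.\<close>
    have "u (of_int (j0 + int i) * h) - \<Gamma> (of_int (j0 + int i) * h) < B (j0 + int i)" if "Suc i0 \<le> i" "i \<le> n" for i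
      using that
    proof (induction i rule: dec_induct)
      case base
      then show ?case using advance[OF u j] chain[OF u, of i0] strict i0 by (simp add: add.assoc add.commute[of 1])
    next
      case (step i)
      then show ?case using advance[OF u, of "j0 + int i"] by (simp add: add.assoc add.commute[of 1])
    qed
    from this[OF i0(2) order_refl] show False using lower[OF u] B_end by (simp add: T_def)
  qed
  show ?thesis using no_pair no_bounded unfolding g_def B_def by blast
qed

end
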